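(* Let $(a_j)_{j\ge1}$ be a sequence of nonnegative integers and define $\tilde c_n$ by $\sum_{n\ge0}\tilde c_nx^n=\prod_{j\ge1}(1+x^j)^{a_j}$ for $|x|<1$. (i) Suppose there are constants $r>0$, $y\ge1$, $D_1,D_2>0$ with $D_1 j^{r-1}y^j\le a_j\le D_2 j^{r-1}y^j$ for all $j\ge1$. For $n$ large, let $\tilde\sigma_n>0$ be chosen so that $\sum_{j=1}^n\frac{ja_je^{-j\tilde\sigma_n}}{1+e^{-j\tilde\sigma_n}}=n$, and let $\tilde B_n^2=\sum_{j=1}^n\frac{j^2a_je^{-j\tilde\sigma_n}}{(1+e^{-j\tilde\sigma_n})^2}$. Then $$\tilde c_n\sim\frac{e^{n\tilde\sigma_n}}{\sqrt{2\pi\tilde B_n^2}}\prod_{j=1}^n\left(1+e^{-j\tilde\sigma_n}\right)^{a_j},\qquad n\to\infty.$$ (ii) Suppose instead that $a_j=Kj^{r-1}y^j+O(y^{\nu j})$ as $j\to\infty$, with $K>0$, $r>0$, $y>1$, $\nu\in(0,1)$. Then there exists a positive constant $\tilde\kappa_1$ such that $$\tilde c_n\sim\tilde\kappa_1 y^n n^{-(r+2)/(2(r+1))}\exp\left(\kappa_2 n^{r/(r+1)}\right),\qquad \kappa_2=\frac{r+1}{r}\left(K\Gamma(r+1)\right)^{1/(r+1)}.$$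
   Context: $\tilde c_n$ is the number of selections of total size $n$, i.e. multisets with exactly $a_j$ component types of size $j$ in which no component type appears more than once. $u_n\sim v_n$ means $u_n/v_n\to1$; $\Gamma$ is the gamma function. *)

theory Defs
  imports "HOL-Analysis.Analysis" "HOL-Library.Landau_Symbols"
begin

text \<open>
  The generating function is the infinite product over all \<open>j \<ge> 1\<close>, taken in the ring of formal
  power series (with its usual metric); the factor for size \<open>j\<close> has index \<open>j - 1\<close>. As a formal
  identity this makes sense for every sequence \<open>a\<close>, also if \<open>a\<close> grows exponentially and
  the product has radius of convergence smaller than \<open>1\<close>. The value \<open>a 0\<close> plays no role.
\<close>

definition selection_gf :: "(nat \<Rightarrow> nat) \<Rightarrow> real fps" where
  "selection_gf a = (\<Prod>j. (1 + fps_X ^ Suc j) ^ a (Suc j))"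

definition selection_num :: "(nat \<Rightarrow> nat) \<Rightarrow> nat \<Rightarrow> real" where
  "selection_num a n = fps_nth (selection_gf a) n"

text \<open>
  Combinatorial meaning: the component types are the pairs \<open>(j, k)\<close> with \<open>j \<ge> 1\<close> and \<open>k < a j\<close>,
  the size of \<open>(j, k)\<close> being \<open>j\<close>; a selection uses every type at most once, i.e. it is a finite
  set of types. The lemmas below show that the product converges and that its coefficients count
  the selections.
\<close>

definition selections :: "(nat \<Rightarrow> nat) \<Rightarrow> nat \<Rightarrow> (nat \<times> nat) set set" where
  "selections a n =
     {S. finite S \<and> S \<subseteq> (SIGMA j:{1..}. {..<a j}) \<and> (\<Sum>s\<in>S. fst s) = n}"

lemma selections_bounded:
  assumes "n \<le> m"
  shows "selections a n = {S \<in> Pow (SIGMA j:{1..m}. {..<a j}). (\<Sum>s\<in>S. fst s) = n}"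
proof (rule set_eqI)
  fix S
  have fin: "finite (SIGMA j:{1..m}. {..<a j})" by simp
  show "S \<in> selections a n \<longleftrightarrow> S \<in> {S \<in> Pow (SIGMA j:{1..m}. {..<a j}). (\<Sum>s\<in>S. fst s) = n}"
  proof
    assume S: "S \<in> selections a n"
    have "fst s \<le> m" if "s \<in> S" for s
    proof -
      have "fst s \<le> (\<Sum>s\<in>S. fst s)"
        using S that by (intro member_le_sum) (auto simp: selections_def)
      with S assms show ?thesis by (auto simp: selections_def)
    qed
    with S show "S \<in> {S \<in> Pow (SIGMA j:{1..m}. {..<a j}). (\<Sum>s\<in>S. fst s) = n}"
      by (force simp: selections_def)
  next
    assume S: "S \<in> {S \<in> Pow (SIGMA j:{1..m}. {..<a j}). (\<Sum>s\<in>S. fst s) = n}"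
    then have "finite S" using fin by (auto intro: finite_subset)
    with S show "S \<in> selections a n" by (fastforce simp: selections_def)
  qed
qed

lemma fps_nth_finite_selection_product:
  assumes "n \<le> m"
  shows "fps_nth (\<Prod>j\<in>{1..m}. (1 + fps_X ^ j) ^ a j :: real fps) n = real (card (selections a n))"
proof -
  define T where "T = (SIGMA j:{1..m}. {..<a j})"
  have fin: "finite T" by (simp add: T_def)
  have "(\<Prod>j\<in>{1..m}. (1 + fps_X ^ j) ^ a j :: real fps)
      = (\<Prod>j\<in>{1..m}. \<Prod>k\<in>{..<a j}. (fps_X ^ j + 1))"
    by (simp add: add.commute)
  also have "\<dots> = (\<Prod>s\<in>T. fps_X ^ fst s + 1)"
    unfolding T_def by (subst prod.Sigma) (auto simp: case_prod_beta)
  also have "\<dots> = (\<Sum>S\<in>Pow T. (\<Prod>s\<in>S. fps_X ^ fst s) * (\<Prod>s\<in>T - S. 1))"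
    by (rule prod_add[OF fin])
  also have "\<dots> = (\<Sum>S\<in>Pow T. fps_X ^ (\<Sum>s\<in>S. fst s))"
    by (simp add: power_sum)
  finally have "fps_nth (\<Prod>j\<in>{1..m}. (1 + fps_X ^ j) ^ a j :: real fps) n
      = (\<Sum>S\<in>Pow T. if n = (\<Sum>s\<in>S. fst s) then 1 else 0)"
    by (simp add: fps_sum_nth fps_X_power_nth)
  also have "\<dots> = (\<Sum>S\<in>{S \<in> Pow T. (\<Sum>s\<in>S. fst s) = n}. 1)"
    using fin by (intro sum.mono_neutral_cong_right) auto
  also have "\<dots> = real (card (selections a n))"
    by (simp add: selections_bounded[OF assms] T_def)
  finally show ?thesis .
qed

lemma selection_gf_has_prod:
  "(\<lambda>j. (1 + fps_X ^ Suc j) ^ a (Suc j) :: real fps) has_prod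
     Abs_fps (\<lambda>n. real (card (selections a n)))"
proof -
  define P where "P = (\<lambda>m. \<Prod>j\<le>m. (1 + fps_X ^ Suc j) ^ a (Suc j) :: real fps)"
  have P: "P m = (\<Prod>j\<in>{1..Suc m}. (1 + fps_X ^ j) ^ a j)" for m
    unfolding P_def
    by (rule prod.reindex_bij_witness[of _ "\<lambda>j. j - 1" Suc]) auto
  have "P \<longlonglongrightarrow> Abs_fps (\<lambda>n. real (card (selections a n)))"
  proof (rule tendsto_fpsI)
    fix n
    show "\<forall>\<^sub>F m in sequentially.
        fps_nth (P m) n = fps_nth (Abs_fps (\<lambda>n. real (card (selections a n)))) n"
      using eventually_ge_at_top[of n]
    proof eventually_elim
      case (elim m)
      then show ?case
        unfolding P fps_nth_finite_selection_product[OF le_SucI[OF elim]] by simp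
    qed
  qed
  moreover have "Abs_fps (\<lambda>n. real (card (selections a n))) \<noteq> 0"
  proof -
    have "selections a 0 = {S \<in> Pow {}. (\<Sum>s\<in>S. fst s) = 0}"
      unfolding selections_bounded[OF order.refl] by simp
    also have "\<dots> = {{}}" by auto
    finally have "fps_nth (Abs_fps (\<lambda>n. real (card (selections a n)))) 0 = 1"
      by simp
    then show ?thesis
      by (intro fps_nonzeroI[of _ 0]) simp
  qed
  ultimately show ?thesis
    unfolding has_prod_def raw_has_prod_def P_def by simp
qed

lemma selection_num_eq_card: "selection_num a n = real (card (selections a n))"
  unfolding selection_num_def selection_gf_def
    has_prod_unique[OF selection_gf_has_prod[of a], symmetric]
  by simp

text \<open>
  The saddle point equation has exactly one solution \<open>s > 0\<close> as soon as \<open>n \<ge> 4\<close> and all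
  \<open>a j\<close> with \<open>j \<ge> 1\<close> are positive.
\<close>

lemma saddle_point_ex1:
  fixes a :: "nat \<Rightarrow> nat"
  assumes a: "\<And>j. j \<ge> 1 \<Longrightarrow> a j > 0" and n: "n \<ge> 4"
  shows "\<exists>!s::real. s > 0 \<and>
    (\<Sum>j=1..n. real j * real (a j) * exp (- real j * s) / (1 + exp (- real j * s))) = real n"
proof -
  define f :: "real \<Rightarrow> real" where
    "f = (\<lambda>s. \<Sum>j=1..n. real j * real (a j) * exp (- real j * s) / (1 + exp (- real j * s)))"
  have alt: "f s = (\<Sum>j=1..n. real j * real (a j) / (1 + exp (real j * s)))" for s
    unfolding f_def by (intro sum.cong refl) (simp add: exp_minus field_simps)
  have mono: "f t < f s" if "s < t" for s t
    unfolding alt using n a that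
    by (intro sum_strict_mono divide_strict_left_mono)
       (auto intro!: mult_pos_pos add_pos_pos)
  have cont: "continuous_on {0..S} f" for S
    unfolding alt [abs_def]
    by (intro continuous_intros) (simp add: add_nonneg_eq_0_iff)
  have "real n < (\<Sum>j=1..n. real j) / 2"
  proof -
    have "(\<Sum>j=1..n. real j) = real n * (real n + 1) / 2"
      by (induction n) (auto simp: field_simps)
    moreover have "real n * 4 < real n * (real n + 1)"
      using n by (intro mult_strict_left_mono) auto
    ultimately show ?thesis by simp
  qed
  also have "\<dots> = (\<Sum>j=1..n. real j / 2)"
    by (simp add: sum_divide_distrib)
  also have "\<dots> \<le> f 0"
    unfolding alt using a by (intro sum_mono) (auto simp: Suc_le_eq)
  finally have f0: "f 0 > real n" .
  have "((\<lambda>s. f s) \<longlongrightarrow> (\<Sum>j=1..n. 0)) at_top"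
    unfolding alt
  proof (intro tendsto_sum)
    fix j assume "j \<in> {1..n}"
    then have "filterlim (\<lambda>s. real j * s) at_top at_top"
      by (intro filterlim_tendsto_pos_mult_at_top[OF tendsto_const _ filterlim_ident]) auto
    then have "filterlim (\<lambda>s. 1 + exp (real j * s)) at_top at_top"
      by (intro filterlim_tendsto_add_at_top[OF tendsto_const] filterlim_compose[OF exp_at_top])
    then show "((\<lambda>s. real j * real (a j) / (1 + exp (real j * s))) \<longlongrightarrow> 0) at_top"
      by (intro tendsto_divide_0[OF tendsto_const] filterlim_at_top_imp_at_infinity)
  qed
  then have "(f \<longlongrightarrow> 0) at_top" by simp
  then have "eventually (\<lambda>s. f s < real n) at_top"
    using n by (intro order_tendstoD) auto
  then obtain S where S: "f S < real n" "S > 0"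
    using eventually_happens'[OF _ eventually_conj[OF _ eventually_gt_at_top[of 0]]]
    by (metis trivial_limit_at_top_linorder)
  obtain s where s: "0 \<le> s" "f s = real n"
    using IVT2'[of f S "real n" 0, OF _ _ _ cont] S f0 by auto
  with f0 have "s > 0" by (cases "s = 0") auto
  moreover have "t = s" if "f t = real n" for t
    using mono[of s t] mono[of t s] s that by (cases s t rule: linorder_cases) auto
  ultimately have "\<exists>!s. s > 0 \<and> f s = real n"
    using s by blast
  then show ?thesis by (simp add: f_def)
qed

end

theory Submission
  imports Defs "HOL-Probability.Characteristic_Functions" "HOL-Probability.Sinc_Integral"
    "HOL-Real_Asymp.Real_Asymp"
begin

text \<open>
  Tilt by \<open>q = exp (- s)\<close>: the factor \<open>(1 + q ^ j * cis (j * t)) ^ a j\<close>, divided by its value at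
  \<open>t = 0\<close>, is the characteristic function of \<open>j\<close> times a sum of \<open>a j\<close> independent Bernoulli
  variables with success probability \<open>boltz_p s j\<close>. So by Fourier inversion \<open>selection_num a n\<close> is,
  up to the factor \<open>exp (n * s)\<close> times the product of the \<open>(1 + exp (- j * s)) ^ a j\<close>, the probability
  that the tilted total size equals \<open>n\<close>, and the Gaussian density comes from a local limit law: third
  and fourth moments control the characteristic function near \<open>0\<close>, and the sizes of order
  \<open>1 / (s - ln y)\<close> make it decay elsewhere. The tilt only needs a mean within \<open>o(\<surd> variance)\<close> of \<open>n\<close>.
  The exact saddle point gives (i); for (ii) an explicit tilt suffices, and then all quantities are
  expanded through sums of \<open>j powr (s - 1) * exp (- j * d)\<close> for \<open>d \<rightarrow> 0\<close>, up to an error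
  converging to a constant.
\<close>

section \<open>Fourier inversion and Bernoulli characteristic functions\<close>

text \<open>Scales: with \<open>d = s - ln y\<close>, the types of size \<open>j\<close> carry total
  weight of order \<open>j powr (r - 1) * exp (- j * d)\<close>, so the moment of order
  \<open>k\<close> is at most of order \<open>d powr (- (r + k))\<close>, and for
  \<open>k = 2\<close> this order is attained. The normalised third and fourth moments are then of
  order \<open>d powr (r / 2)\<close> and \<open>d powr r\<close>, and vanish because
  \<open>r > 0\<close>. Frequencies far from 0 are the obstacle, since a lattice effect could keep
  the characteristic function large there. A window of consecutive sizes excludes it:
  \<open>j * t\<close> cannot stay near multiples of \<open>2 * pi\<close> for all \<open>j\<close>
  in the window. The window fits below the truncation at \<open>n\<close> because
  \<open>n * d\<close> tends to infinity. In (ii) the exponent must be known up to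
  \<open>o(1)\<close>, while comparison of coefficients yields \<open>polyexp\<close> only up to a
  factor \<open>1 + o(1)\<close>. The missing constant term comes from a duplication formula instead
  of a Mellin transform. As \<open>y > 1\<close>, the squared weights are summable, so replacing
  \<open>ln (1 + x)\<close> by \<open>x\<close> costs only a convergent sum; the limits of all these
  errors enter the constant \<open>\<kappa>1\<close>.\<close>

lemma has_integral_cis_period:
  fixes k :: int
  assumes "B > 0"
  shows "((\<lambda>u. cis (of_int k * (u / B))) has_integral (if k = 0 then of_real (2 * pi * B) else 0))
           {-(pi * B)..pi * B}"
proof (cases "k = 0")
  case True
  have "((\<lambda>u::real. 1 :: complex) has_integral of_real (2 * pi * B)) {-(pi * B)..pi * B}"
    using has_integral_const_real[of "1::complex" "-(pi * B)" "pi * B"] assms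
    by (simp add: scaleR_conv_of_real mult_ac)
  then show ?thesis using True by simp
next
  case False
  define F where "F = (\<lambda>u. cis (of_int k * (u / B)) * of_real (B / of_int k) / \<i>)"
  have "((\<lambda>u. cis (of_int k * (u / B))) has_integral (F (pi * B) - F (-(pi * B)))) {-(pi * B)..pi * B}"
  proof (rule fundamental_theorem_of_calculus)
    show "-(pi * B) \<le> pi * B" using assms by simp
    fix u
    define G where "G = (\<lambda>z. exp (\<i> * (of_int k * (z / of_real B))) * of_real (B / of_int k) / \<i>)"
    have "(G has_field_derivative exp (\<i> * (of_int k * (of_real u / of_real B)))) (at (of_real u))"
      unfolding G_def using False assms by (auto intro!: derivative_eq_intros simp: field_simps)
    from has_vector_derivative_real_field[OF this]
    show "(F has_vector_derivative cis (of_int k * (u / B))) (at u within {-(pi * B)..pi * B})"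
      by (simp add: F_def G_def cis_conv_exp)
  qed
  moreover have "F (pi * B) = F (-(pi * B))"
  proof -
    have "cis (of_int k * pi) = cis (- (of_int k * pi))"
      by (auto simp: complex_eq_iff sin_times_pi_eq_0 mult.commute)
    then show ?thesis using assms by (simp add: F_def)
  qed
  ultimately show ?thesis using False by simp
qed

text \<open>Expanding the product gives one monomial per selection from sizes up to
  \<open>m\<close>, and orthogonality keeps those of total size \<open>n\<close>; a type larger than
  \<open>n\<close> cannot occur in them, hence \<open>n \<le> m\<close> is enough. The variable
  \<open>u = B * t\<close> is the scale on which the integrand has a fixed Gaussian limit.\<close>

lemma selection_num_Fourier:
  assumes "n \<le> m" "B > 0"
  shows "((\<lambda>u. (\<Prod>j=1..m. (1 + (of_real q * cis (u / B)) ^ j) ^ a j) * cis (- (real n * (u / B))))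
           has_integral of_real (2 * pi * B * q ^ n * selection_num a n)) {-(pi * B)..pi * B}"
proof -
  define T where "T = (SIGMA j:{1..m}. {..<a j})"
  define w where "w = (\<lambda>S :: (nat \<times> nat) set. \<Sum>s\<in>S. fst s)"
  have fin: "finite T" by (simp add: T_def)
  have expand: "(\<Prod>j=1..m. (1 + z ^ j) ^ a j) = (\<Sum>S\<in>Pow T. z ^ w S)" for z :: complex
  proof -
    have "(\<Prod>j=1..m. (1 + z ^ j) ^ a j) = (\<Prod>j\<in>{1..m}. \<Prod>k\<in>{..<a j}. (z ^ j + 1))"
      by (simp add: add.commute)
    also have "\<dots> = (\<Prod>s\<in>T. z ^ fst s + 1)"
      unfolding T_def by (subst prod.Sigma) (auto simp: case_prod_beta)
    also have "\<dots> = (\<Sum>S\<in>Pow T. (\<Prod>s\<in>S. z ^ fst s) * (\<Prod>s\<in>T - S. 1))"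
      by (rule prod_add[OF fin])
    finally show ?thesis by (simp add: power_sum w_def)
  qed
  have "((\<lambda>u. \<Sum>S\<in>Pow T. of_real q ^ w S * cis (of_int (int (w S) - int n) * (u / B)))
      has_integral (\<Sum>S\<in>Pow T. of_real q ^ w S *
        (if int (w S) - int n = 0 then of_real (2 * pi * B) else 0))) {-(pi * B)..pi * B}"
    using fin by (intro has_integral_sum has_integral_mult_right has_integral_cis_period assms) auto
  also have "(\<lambda>u. \<Sum>S\<in>Pow T. of_real q ^ w S * cis (of_int (int (w S) - int n) * (u / B)))
      = (\<lambda>u. (\<Prod>j=1..m. (1 + (of_real q * cis (u / B)) ^ j) ^ a j) * cis (- (real n * (u / B))))"
  proof (intro ext)
    fix u
    have "(of_real q * cis (u / B)) ^ k * cis (- (real n * (u / B)))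
        = of_real q ^ k * cis (of_int (int k - int n) * (u / B))" for k
      by (simp add: power_mult_distrib Complex.DeMoivre cis_mult ring_distribs diff_divide_distrib left_diff_distrib)
    then show "(\<Sum>S\<in>Pow T. of_real q ^ w S * cis (of_int (int (w S) - int n) * (u / B)))
      = (\<Prod>j=1..m. (1 + (of_real q * cis (u / B)) ^ j) ^ a j) * cis (- (real n * (u / B)))"
      unfolding expand by (simp add: sum_distrib_right)
  qed
  also have "(\<Sum>S\<in>Pow T. of_real q ^ w S * (if int (w S) - int n = 0 then of_real (2 * pi * B) else 0))
      = (\<Sum>S\<in>{S\<in>Pow T. w S = n}. of_real q ^ n * of_real (2 * pi * B) :: complex)"
    using fin by (intro sum.mono_neutral_cong_right) auto
  also have "\<dots> = of_real (2 * pi * B * q ^ n * selection_num a n)"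
    by (simp add: selection_num_eq_card selections_bounded[OF assms(1)] T_def w_def)
  finally show ?thesis .
qed

text \<open>The squared modulus equals \<open>1 - 2 * p * (1 - p) * (1 - cos \<theta>)\<close>; then
  \<open>1 + x \<le> exp x\<close>.\<close>

lemma bernoulli_char_norm_le:
  fixes p \<theta> :: real
  assumes "0 \<le> p" "p \<le> 1"
  shows "cmod (of_real (1 - p) + of_real p * cis \<theta>) \<le> exp (- (p * (1 - p) * (1 - cos \<theta>)))"
proof -
  have "(cmod (of_real (1 - p) + of_real p * cis \<theta>))\<^sup>2
      = (1 - p)\<^sup>2 + 2 * p * (1 - p) * cos \<theta> + (p\<^sup>2 * (cos \<theta>)\<^sup>2 + p\<^sup>2 * (sin \<theta>)\<^sup>2)"
    by (simp only: cmod_power2) (simp add: power2_eq_square algebra_simps)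
  also have "p\<^sup>2 * (cos \<theta>)\<^sup>2 + p\<^sup>2 * (sin \<theta>)\<^sup>2 = p\<^sup>2"
    by (simp flip: distrib_left)
  also have "(1 - p)\<^sup>2 + 2 * p * (1 - p) * cos \<theta> + p\<^sup>2 = 1 + - (2 * (p * (1 - p) * (1 - cos \<theta>)))"
    by (simp add: power2_eq_square algebra_simps)
  also have "\<dots> \<le> exp (- (2 * (p * (1 - p) * (1 - cos \<theta>))))"
    by (rule exp_ge_add_one_self)
  also have "\<dots> = (exp (- (p * (1 - p) * (1 - cos \<theta>))))\<^sup>2"
    by (simp add: power2_eq_square flip: exp_add)
  finally show ?thesis
    by (rule power2_le_imp_le) simp
qed

lemma exp_minus_quadratic_bounds:
  fixes z :: real
  assumes "z \<ge> 0"
  shows "\<bar>exp (- z) - (1 - z)\<bar> \<le> z\<^sup>2 / 2"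
proof -
  have "exp (- z) \<ge> 1 - z" using exp_ge_add_one_self[of "-z"] by simp
  moreover have "exp (- z) \<le> 1 - z + z\<^sup>2 / 2"
  proof -
    have q: "1 - z + z\<^sup>2 / 2 > 0"
      using sum_power2_gt_zero_iff[of "1 - z" 1] by (simp add: power2_eq_square algebra_simps)
    \<comment> \<open>The quadratic Taylor polynomials of \<open>exp z\<close> and
      \<open>exp (- z)\<close> multiply to at least 1, so the lower bound for \<open>exp z\<close>
      turns into an upper bound for \<open>exp (- z)\<close>.\<close>
    have "(1 + z + z\<^sup>2 / 2) * (1 - z + z\<^sup>2 / 2) = 1 + z ^ 4 / 4"
      by (simp add: eval_nat_numeral field_simps)
    then have "1 \<le> (1 + z + z\<^sup>2 / 2) * (1 - z + z\<^sup>2 / 2)"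
      by simp
    also have "\<dots> \<le> exp z * (1 - z + z\<^sup>2 / 2)"
      using exp_lower_Taylor_quadratic[OF assms] q by (intro mult_right_mono) auto
    finally show ?thesis by (simp add: exp_minus field_simps)
  qed
  ultimately show ?thesis by linarith
qed

text \<open>Centring leaves the values \<open>- p * \<theta>\<close> and
  \<open>(1 - p) * \<theta>\<close> with weights \<open>1 - p\<close> and \<open>p\<close>; their
  linear terms cancel and their quadratic terms add up to \<open>v\<close>. The cubic error is the
  Taylor remainder of \<open>cis\<close>, the quartic one that of \<open>exp\<close>. Both keep the
  factor \<open>v\<close>, so that summing over all types yields moments weighted by
  variances.\<close>

lemma bernoulli_char_approx:
  fixes p \<theta> :: real
  assumes p: "0 \<le> p" "p \<le> 1"
  defines "v \<equiv> p * (1 - p)"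
  shows "cmod (cis (- (p * \<theta>)) * (of_real (1 - p) + of_real p * cis \<theta>) - of_real (exp (- (v * \<theta>\<^sup>2 / 2))))
           \<le> v * \<bar>\<theta>\<bar> ^ 3 + v * \<theta> ^ 4"
proof -
  define R where "R = (\<lambda>x::real. cis x - (1 + \<i> * of_real x - of_real (x\<^sup>2 / 2)))"
  have R: "cmod (R x) \<le> \<bar>x\<bar> ^ 3 / 6" for x
  proof -
    have "(\<Sum>k\<le>2. (\<i> * complex_of_real x)^k / fact k) = 1 + \<i> * of_real x - of_real (x\<^sup>2 / 2)"
      by (simp add: numeral_2_eq_2 power_mult_distrib)
    then show ?thesis
      using iexp_approx1[of x 2] by (simp add: R_def cis_conv_exp eval_nat_numeral)
  qed
  have v: "0 \<le> v" "v \<le> 1" using p by (auto simp: v_def intro: mult_le_one)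
  define E where "E = exp (- (v * \<theta>\<^sup>2 / 2)) - (1 - v * \<theta>\<^sup>2 / 2)"
  have "cis (- (p * \<theta>)) * (of_real (1 - p) + of_real p * cis \<theta>)
      = of_real (1 - p) * cis (- (p * \<theta>)) + of_real p * cis ((1 - p) * \<theta>)"
    by (simp add: algebra_simps cis_mult)
  also have "\<dots> = of_real (1 - p) * R (- (p * \<theta>)) + of_real p * R ((1 - p) * \<theta>) + of_real (1 - v * \<theta>\<^sup>2 / 2)"
    by (simp add: R_def v_def power2_eq_square field_simps)
  finally have "cis (- (p * \<theta>)) * (of_real (1 - p) + of_real p * cis \<theta>) - of_real (exp (- (v * \<theta>\<^sup>2 / 2)))
      = of_real (1 - p) * R (- (p * \<theta>)) + of_real p * R ((1 - p) * \<theta>) - of_real E"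
    by (simp add: E_def)
  also have "cmod \<dots> \<le> (1 - p) * cmod (R (- (p * \<theta>))) + p * cmod (R ((1 - p) * \<theta>)) + \<bar>E\<bar>"
    using p by (intro order.trans[OF norm_triangle_ineq4] add_mono order.trans[OF norm_triangle_ineq])
      (auto simp: norm_mult simp flip: of_real_diff)
  also have "\<dots> \<le> (1 - p) * (p ^ 3 * \<bar>\<theta>\<bar> ^ 3 / 6) + p * ((1 - p) ^ 3 * \<bar>\<theta>\<bar> ^ 3 / 6) + (v * \<theta>\<^sup>2 / 2)\<^sup>2 / 2"
  proof (intro add_mono mult_left_mono)
    show "cmod (R (- (p * \<theta>))) \<le> p ^ 3 * \<bar>\<theta>\<bar> ^ 3 / 6"
      using R[of "- (p * \<theta>)"] p by (simp add: abs_mult power_mult_distrib)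
    show "cmod (R ((1 - p) * \<theta>)) \<le> (1 - p) ^ 3 * \<bar>\<theta>\<bar> ^ 3 / 6"
      using R[of "(1 - p) * \<theta>"] p by (simp add: abs_mult power_mult_distrib)
    show "\<bar>E\<bar> \<le> (v * \<theta>\<^sup>2 / 2)\<^sup>2 / 2"
      unfolding E_def using v by (intro exp_minus_quadratic_bounds) auto
  qed (use p in auto)
  also have "\<dots> \<le> v * \<bar>\<theta>\<bar> ^ 3 + v * \<theta> ^ 4"
  proof (intro add_mono)
    have "(1 - p) * (p ^ 3 * \<bar>\<theta>\<bar> ^ 3 / 6) + p * ((1 - p) ^ 3 * \<bar>\<theta>\<bar> ^ 3 / 6)
        = (v * \<bar>\<theta>\<bar> ^ 3) * ((p\<^sup>2 + (1 - p)\<^sup>2) / 6)"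
      by (simp add: v_def power2_eq_square power3_eq_cube field_simps)
    also have "\<dots> \<le> (v * \<bar>\<theta>\<bar> ^ 3) * 1"
    proof (intro mult_left_mono)
      have "p\<^sup>2 \<le> 1" "(1 - p)\<^sup>2 \<le> 1" using p by (auto intro!: power_le_one)
      then show "(p\<^sup>2 + (1 - p)\<^sup>2) / 6 \<le> 1" by simp
    qed (use v in auto)
    finally show "(1 - p) * (p ^ 3 * \<bar>\<theta>\<bar> ^ 3 / 6) + p * ((1 - p) ^ 3 * \<bar>\<theta>\<bar> ^ 3 / 6) \<le> v * \<bar>\<theta>\<bar> ^ 3"
      by simp
    have "(v * \<theta>\<^sup>2 / 2)\<^sup>2 / 2 = (v * \<theta> ^ 4) * (v / 8)"
      by (simp add: power2_eq_square eval_nat_numeral)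
    also have "\<dots> \<le> (v * \<theta> ^ 4) * 1"
      using v by (intro mult_left_mono) auto
    finally show "(v * \<theta>\<^sup>2 / 2)\<^sup>2 / 2 \<le> v * \<theta> ^ 4" by simp
  qed
  finally show ?thesis .
qed

section \<open>Lower bounds for \<open>1 - cos\<close> and its sums over a window\<close>

text \<open>Jordan's inequality \<open>sin (y / 2) \<ge> y / pi\<close>, from concavity of
  \<open>sin\<close>, squared by the half-angle formula.\<close>

lemma one_minus_cos_ge:
  fixes x :: real
  assumes "\<bar>x\<bar> \<le> pi"
  shows "1 - cos x \<ge> 2 * (x / pi)\<^sup>2"
proof -
  have c: "cos y \<le> 1 - 2 * (y / pi)\<^sup>2" if "0 \<le> y" "y \<le> pi" for y
  proof -
    have "sin (y / 2) \<ge> y / pi"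
    proof -
      have "concave_on {0..pi} sin"
        unfolding concave_on_def
      proof (rule f''_ge0_imp_convex)
        show "((\<lambda>x. - sin x) has_real_derivative - cos x) (at x)" for x :: real
          by (auto intro!: derivative_eq_intros)
        show "((\<lambda>x. - cos x) has_real_derivative sin x) (at x)" for x :: real
          by (auto intro!: derivative_eq_intros)
      qed (auto intro: sin_ge_zero)
      then have "sin ((1 - y / pi) *\<^sub>R 0 + (y / pi) *\<^sub>R (pi / 2)) \<ge> (1 - y / pi) * sin 0 + (y / pi) * sin (pi / 2)"
        using that pi_gt_zero by (intro concave_onD) (auto simp: field_simps)
      then show ?thesis by simp
    qed
    then have "(y / pi)\<^sup>2 \<le> (sin (y / 2))\<^sup>2"
      using that by (intro power_mono) auto
    moreover have "cos y = 1 - 2 * (sin (y / 2))\<^sup>2"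
      using cos_double_sin[of "y / 2"] by simp
    ultimately show ?thesis by simp
  qed
  show ?thesis using c[of x] c[of "-x"] assms by (cases "x \<ge> 0") auto
qed

text \<open>With \<open>1 - cos z = 2 * (sin (z / 2))\<^sup>2\<close> this is subadditivity of the
  absolute sine followed by
  \<open>(a + b)\<^sup>2 \<le> 2 * a\<^sup>2 + 2 * b\<^sup>2\<close>.\<close>

lemma one_minus_cos_diff_le:
  fixes x y :: real
  shows "1 - cos (x - y) \<le> 2 * (1 - cos x) + 2 * (1 - cos y)"
proof -
  have *: "1 - cos z = 2 * (sin (z / 2))\<^sup>2" for z :: real
    using cos_double_sin[of "z / 2"] by simp
  have "sin ((x - y) / 2) = sin (x / 2) * cos (y / 2) - cos (x / 2) * sin (y / 2)"
    by (simp add: diff_divide_distrib sin_diff)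
  then have "\<bar>sin ((x - y) / 2)\<bar> \<le> \<bar>sin (x / 2)\<bar> * \<bar>cos (y / 2)\<bar> + \<bar>cos (x / 2)\<bar> * \<bar>sin (y / 2)\<bar>"
    by (metis abs_mult abs_triangle_ineq4)
  also have "\<dots> \<le> \<bar>sin (x / 2)\<bar> * 1 + 1 * \<bar>sin (y / 2)\<bar>"
    by (intro add_mono mult_left_mono mult_right_mono) auto
  finally have "(sin ((x - y) / 2))\<^sup>2 \<le> (\<bar>sin (x / 2)\<bar> + \<bar>sin (y / 2)\<bar>)\<^sup>2"
    by (metis abs_ge_zero mult.right_neutral mult_1 power2_abs power_mono)
  also have "\<dots> \<le> 2 * (sin (x / 2))\<^sup>2 + 2 * (sin (y / 2))\<^sup>2"
    using zero_le_power2[of "\<bar>sin (x / 2)\<bar> - \<bar>sin (y / 2)\<bar>"] by (simp add: power2_eq_square algebra_simps)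
  finally show ?thesis unfolding * by simp
qed

text \<open>Some shift \<open>m \<le> N\<close> keeps \<open>m * t\<close> away from the multiples
  of \<open>2 * pi\<close>: \<open>m = N\<close> if \<open>N * \<bar>t\<bar> \<le> pi\<close>, and
  otherwise the integer part of \<open>pi / \<bar>t\<bar>\<close>, which puts
  \<open>m * \<bar>t\<bar>\<close> between \<open>pi / 2\<close> and \<open>pi\<close>. Then
  \<open>j * t\<close> and \<open>(j + m) * t\<close> cannot both be close to multiples of
  \<open>2 * pi\<close>. The pairs \<open>j\<close>, \<open>j + m\<close> with
  \<open>N < j \<le> 2 * N\<close> stay in the window and use each index at most twice, which
  accounts for the factor \<open>1 / 4\<close>.\<close>

lemma sum_one_minus_cos_ge:
  fixes t :: real and N :: nat
  assumes t: "\<bar>t\<bar> \<le> pi" and N: "N \<ge> 1"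
  shows "(\<Sum>j=N+1..3*N. 1 - cos (real j * t)) \<ge> real N / 4 * min 1 ((real N * t / pi)\<^sup>2)"
proof -
  obtain m :: nat where m: "m \<le> N" and gap: "1 - cos (real m * t) \<ge> min 1 ((real N * t / pi)\<^sup>2)"
  proof (cases "real N * \<bar>t\<bar> \<le> pi")
    case True
    have "1 - cos (real N * t) \<ge> 2 * (real N * t / pi)\<^sup>2"
      using True by (intro one_minus_cos_ge) (auto simp: abs_mult)
    then have "min 1 ((real N * t / pi)\<^sup>2) \<le> 1 - cos (real N * t)"
      using zero_le_power2[of "real N * t / pi"] by linarith
    then show thesis by (intro that[of N]) auto
  next
    case False
    then have t0: "\<bar>t\<bar> > 0" using pi_gt_zero by (cases "t = 0") auto
    define m where "m = nat \<lfloor>pi / \<bar>t\<bar>\<rfloor>"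
    have q: "pi / \<bar>t\<bar> \<ge> 1" using t t0 by simp
    have "\<lfloor>pi / \<bar>t\<bar>\<rfloor> \<ge> 1" using q by simp
    then have m1: "real m \<le> pi / \<bar>t\<bar>" "real m > pi / \<bar>t\<bar> - 1" "real m \<ge> 1"
      unfolding m_def using q by (linarith+)
    have mt: "real m * \<bar>t\<bar> \<le> pi" using m1(1) t0 by (simp add: field_simps)
    have "pi / \<bar>t\<bar> \<le> 2 * real m" using m1 by linarith
    then have mt2: "pi / 2 \<le> real m * \<bar>t\<bar>" using t0 by (simp add: field_simps)
    have "real m \<le> real N"
    proof -
      have "real m * \<bar>t\<bar> \<le> real N * \<bar>t\<bar>" using mt False by linarith
      then show ?thesis using t0 by simp
    qed
    moreover have "cos (real m * \<bar>t\<bar>) \<le> 0"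
      using mt mt2 by (intro cos_monotone_0_pi_le[of "pi/2", simplified]) auto
    then have "cos (real m * t) \<le> 0"
      using cos_abs_real[of "real m * t"] by (simp add: abs_mult)
    ultimately show thesis by (intro that[of m]) auto
  qed
  define f where "f = (\<lambda>j. 1 - cos (real j * t))"
  have f0: "f j \<ge> 0" for j by (simp add: f_def)
  have "real N / 2 * min 1 ((real N * t / pi)\<^sup>2) = (\<Sum>j=N+1..2*N. min 1 ((real N * t / pi)\<^sup>2) / 2)"
    by simp
  also have "\<dots> \<le> (\<Sum>j=N+1..2*N. f j + f (j + m))"
  proof (intro sum_mono)
    fix j
    have "1 - cos (real m * t) \<le> 2 * f (j + m) + 2 * f j"
      using one_minus_cos_diff_le[of "real (j + m) * t" "real j * t"] by (simp add: f_def algebra_simps)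
    then show "min 1 ((real N * t / pi)\<^sup>2) / 2 \<le> f j + f (j + m)" using gap by simp
  qed
  also have "\<dots> = (\<Sum>j=N+1..2*N. f j) + (\<Sum>j=N+1+m..2*N+m. f j)"
    by (simp add: sum.distrib sum.shift_bounds_cl_nat_ivl[symmetric])
  also have "\<dots> \<le> (\<Sum>j=N+1..3*N. f j) + (\<Sum>j=N+1..3*N. f j)"
    using m by (intro add_mono sum_mono2) (auto simp: f0)
  finally show ?thesis by (simp add: f_def)
qed

section \<open>Sums of powers times exponentials\<close>

text \<open>This is the polylogarithm of order \<open>1 - s\<close> at \<open>exp (- d)\<close>. The
  index 0 contributes nothing, for every \<open>s\<close>, because
  \<open>0 powr x = 0\<close>.\<close>

definition polyexp :: "real \<Rightarrow> real \<Rightarrow> real" where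
  "polyexp s d = (\<Sum>n. real n powr (s - 1) * exp (- (real n * d)))"

lemma summable_powr_power:
  fixes \<alpha> z :: real
  assumes "\<bar>z\<bar> < 1"
  shows "summable (\<lambda>n. real n powr \<alpha> * z ^ n)"
proof (cases "z = 0")
  case True
  then show ?thesis by (intro summable_finite[of "{0}"]) (auto simp: power_0_left)
next
  case False
  define d where "d = - ln \<bar>z\<bar>"
  have d: "d > 0" "\<bar>z\<bar> = exp (- d)" using False assms by (auto simp: d_def)
  have "\<forall>\<^sub>F n in sequentially. real n powr \<alpha> * exp (- d * real n) \<le> exp (- (d / 2) * real n)"
    using d(1) by real_asymp
  then have "\<forall>\<^sub>F n in sequentially. norm (real n powr \<alpha> * z ^ n) \<le> exp (- (d / 2)) ^ n"
    by eventually_elim (simp add: abs_mult power_abs d(2) mult_ac flip: exp_of_nat_mult)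
  then show ?thesis
    using d(1) by (intro summable_comparison_test_ev[OF _ summable_geometric[of "exp (- (d / 2))"]]) auto
qed

lemma summable_polyexp:
  assumes "d > 0"
  shows "summable (\<lambda>n. real n powr \<alpha> * exp (- (real n * d)))"
  using summable_powr_power[of "exp (- d)" \<alpha>] assms by (simp flip: exp_of_nat_mult)


section \<open>Leading behaviour of \<open>polyexp\<close> at 0\<close>

text \<open>Gauss's limit formula for \<open>Gamma\<close>; the factor \<open>1 + s / n\<close>
  removes the last factor of the Pochhammer symbol of length \<open>n + 1\<close> in
  \<open>Gamma_series\<close>.\<close>

lemma pochhammer_div_fact_asymp:
  fixes s :: real
  assumes "s > 0"
  shows "(\<lambda>n. real n powr (s - 1) / (pochhammer s n / fact n)) \<longlonglongrightarrow> Gamma s"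
proof -
  have "(\<lambda>n. Gamma_series s n * (1 + s / real n)) \<longlonglongrightarrow> Gamma s * (1 + 0)"
    by (intro tendsto_intros Gamma_series_LIMSEQ tendsto_divide_0[OF tendsto_const]
        filterlim_compose[OF filterlim_at_top_imp_at_infinity[OF filterlim_real_sequentially] filterlim_ident])
  moreover have "\<forall>\<^sub>F n in sequentially. Gamma_series s n * (1 + s / real n)
      = real n powr (s - 1) / (pochhammer s n / fact n)"
    using eventually_gt_at_top[of 0]
  proof eventually_elim
    case (elim n)
    have p: "pochhammer s n > 0" by (rule pochhammer_pos[OF assms])
    have "exp (s * ln (real n)) = real n powr s" using elim by (simp add: powr_def)
    moreover have "1 + s / real n = (s + real n) / real n" using elim by (simp add: field_simps)
    ultimately have "Gamma_series s n * (1 + s / real n)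
        = real n powr s * fact n / (pochhammer s n * (s + real n)) * ((s + real n) / real n)"
      by (simp add: Gamma_series_def pochhammer_Suc)
    also have "\<dots> = real n powr s * fact n / (pochhammer s n * real n)"
      using assms by (simp add: add_pos_nonneg less_imp_neq[symmetric])
    also have "\<dots> = real n powr (s - 1) / (pochhammer s n / fact n)"
      using elim p by (simp add: powr_diff)
    finally show ?case .
  qed
  ultimately show ?thesis by (simp add: tendsto_cong)
qed

lemma sums_pochhammer_powr:
  fixes s x :: real
  assumes "\<bar>x\<bar> < 1"
  shows "(\<lambda>n. pochhammer s n / fact n * x ^ n) sums ((1 - x) powr (- s))"
proof -
  have "(\<lambda>n. (- s gchoose n) * (- x) ^ n) sums (1 + - x) powr (- s)"
    using assms by (intro gen_binomial_real) auto
  moreover have "(- s gchoose n) * (- x) ^ n = pochhammer s n / fact n * x ^ n" for n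
  proof -
    define m :: real where "m = (-1) ^ n"
    have "m * m = 1" by (simp add: m_def flip: power_mult_distrib)
    have "(- s gchoose n) * (- x) ^ n = m * pochhammer s n / fact n * (m * x ^ n)"
      unfolding gbinomial_pochhammer power_minus[of x] m_def by simp
    also have "\<dots> = (m * m) * (pochhammer s n / fact n * x ^ n)" by simp
    finally show ?thesis unfolding \<open>m * m = 1\<close> by simp
  qed
  ultimately show ?thesis by simp
qed

text \<open>An Abelian comparison: the coefficients \<open>n powr (s - 1)\<close> are asymptotic to
  \<open>Gamma s\<close> times those of \<open>(1 - x) powr (- s)\<close>. The finitely many indices
  where the ratio is not yet close contribute at most \<open>C\<close>, which the factor
  \<open>(1 - x) powr s\<close> sends to 0; finally \<open>1 - exp (- d)\<close> is exchanged for
  \<open>d\<close>.\<close>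

lemma tendsto_polyexp_leading:
  fixes s :: real
  assumes s: "s > 0"
  shows "((\<lambda>d. polyexp s d * d powr s) \<longlongrightarrow> Gamma s) (at_right 0)"
proof -
  define f where "f = (\<lambda>n. real n powr (s - 1))"
  define g where "g = (\<lambda>n. pochhammer s n / fact n)"
  have g: "g n > 0" for n using pochhammer_pos[OF s] by (simp add: g_def)
  have lim: "((\<lambda>d. polyexp s d * (1 - exp (- d)) powr s) \<longlongrightarrow> Gamma s) (at_right 0)"
  proof (rule tendstoI)
    fix e :: real assume e: "e > 0"
    have "(\<lambda>n. f n / g n) \<longlonglongrightarrow> Gamma s"
      unfolding f_def g_def by (rule pochhammer_div_fact_asymp[OF s])
    then have "\<forall>\<^sub>F n in sequentially. dist (f n / g n) (Gamma s) < e / 2"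
      using e by (intro tendstoD) auto
    then obtain N where "\<And>n. n \<ge> N \<Longrightarrow> \<bar>f n / g n - Gamma s\<bar> < e / 2"
      by (auto simp: eventually_sequentially dist_real_def)
    then have N: "\<bar>f n - Gamma s * g n\<bar> \<le> e / 2 * g n" if "n \<ge> N" for n
    proof -
      have "f n - Gamma s * g n = (f n / g n - Gamma s) * g n" using g[of n] by (simp add: field_simps)
      then show ?thesis using that \<open>\<And>n. n \<ge> N \<Longrightarrow> \<bar>f n / g n - Gamma s\<bar> < e / 2\<close>[of n] g[of n]
        by (auto simp: abs_mult intro!: mult_right_mono)
    qed
    define C where "C = (\<Sum>n<N. \<bar>f n - Gamma s * g n\<bar>)"
    have "((\<lambda>d. C * (1 - exp (- d)) powr s) \<longlongrightarrow> 0) (at_right 0)"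
      using s by real_asymp
    then have "\<forall>\<^sub>F d in at_right 0. C * (1 - exp (- d)) powr s < e / 2"
      using e by (intro order_tendstoD) auto
    then show "\<forall>\<^sub>F d in at_right 0. dist (polyexp s d * (1 - exp (- d)) powr s) (Gamma s) < e"
      using eventually_at_right_less[of 0]
    proof eventually_elim
      case (elim d)
      define x where "x = exp (- d)"
      have x: "0 < x" "x < 1" using elim by (auto simp: x_def)
      have sf: "summable (\<lambda>n. f n * x ^ n)" unfolding f_def using x by (intro summable_powr_power) auto
      have P: "polyexp s d = (\<Sum>n. f n * x ^ n)"
        unfolding polyexp_def f_def x_def by (simp flip: exp_of_nat_mult)
      have gs: "(\<lambda>n. g n * x ^ n) sums ((1 - x) powr (- s))"
        unfolding g_def using x by (intro sums_pochhammer_powr) auto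
      have sd: "(\<lambda>n. f n * x ^ n - Gamma s * (g n * x ^ n)) sums
          (polyexp s d - Gamma s * (1 - x) powr (- s))"
        unfolding P by (intro sums_diff sums_mult gs summable_sums sf)
      have "\<bar>f n * x ^ n - Gamma s * (g n * x ^ n)\<bar>
          \<le> (if n < N then \<bar>f n - Gamma s * g n\<bar> else 0) + e / 2 * (g n * x ^ n)" for n
      proof -
        have "f n * x ^ n - Gamma s * (g n * x ^ n) = (f n - Gamma s * g n) * x ^ n"
          by (simp add: algebra_simps)
        then have eq: "\<bar>f n * x ^ n - Gamma s * (g n * x ^ n)\<bar> = \<bar>f n - Gamma s * g n\<bar> * x ^ n"
          using x by (simp add: abs_mult)
        show ?thesis
        proof (cases "n < N")
          case True
          have "\<bar>f n - Gamma s * g n\<bar> * x ^ n \<le> \<bar>f n - Gamma s * g n\<bar> * 1"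
            using x by (intro mult_left_mono power_le_one) auto
          moreover have "e / 2 * (g n * x ^ n) \<ge> 0" using e g[of n] x by simp
          ultimately show ?thesis unfolding eq using True by simp
        next
          case False
          then show ?thesis unfolding eq using N[of n] x by (auto simp flip: mult.assoc intro!: mult_right_mono)
        qed
      qed
      moreover have G: "(\<lambda>n. (if n < N then \<bar>f n - Gamma s * g n\<bar> else 0) + e / 2 * (g n * x ^ n)) sums
          (C + e / 2 * (1 - x) powr (- s))"
        using sums_If_finite_set[of "{..<N}" "\<lambda>n. \<bar>f n - Gamma s * g n\<bar>"]
        unfolding C_def by (intro sums_add sums_mult gs) auto
      ultimately have "norm (\<Sum>n. f n * x ^ n - Gamma s * (g n * x ^ n))
          \<le> (\<Sum>n. (if n < N then \<bar>f n - Gamma s * g n\<bar> else 0) + e / 2 * (g n * x ^ n))"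
        by (intro norm_suminf_le; simp add: sums_iff)
      then have "\<bar>polyexp s d - Gamma s * (1 - x) powr (- s)\<bar> \<le> C + e / 2 * (1 - x) powr (- s)"
        unfolding sums_unique[OF G, symmetric] using sd by (simp add: sums_iff)
      then have "\<bar>polyexp s d - Gamma s * (1 - x) powr (- s)\<bar> * (1 - x) powr s
          \<le> (C + e / 2 * (1 - x) powr (- s)) * (1 - x) powr s"
        by (intro mult_right_mono) auto
      moreover have "(1 - x) powr (- s) * (1 - x) powr s = 1"
        using x by (simp flip: powr_add)
      then have "polyexp s d * (1 - x) powr s - Gamma s
            = (polyexp s d - Gamma s * (1 - x) powr (- s)) * (1 - x) powr s"
        and "(C + e / 2 * (1 - x) powr (- s)) * (1 - x) powr s = C * (1 - x) powr s + e / 2"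
        by (simp_all add: ring_distribs)
      moreover have "\<bar>(polyexp s d - Gamma s * (1 - x) powr (- s)) * (1 - x) powr s\<bar>
          = \<bar>polyexp s d - Gamma s * (1 - x) powr (- s)\<bar> * (1 - x) powr s"
        by (simp add: abs_mult)
      ultimately have "\<bar>polyexp s d * (1 - x) powr s - Gamma s\<bar> \<le> C * (1 - x) powr s + e / 2"
        by linarith
      then show ?case using elim by (simp add: dist_real_def x_def)
    qed
  qed
  have "((\<lambda>d. (d / (1 - exp (- d))) powr s) \<longlongrightarrow> 1) (at_right (0::real))"
    by real_asymp
  then have "((\<lambda>d. polyexp s d * (1 - exp (- d)) powr s * (d / (1 - exp (- d))) powr s) \<longlongrightarrow> Gamma s * 1) (at_right 0)"
    by (intro tendsto_mult lim)
  moreover have "\<forall>\<^sub>F d in at_right (0::real). polyexp s d * (1 - exp (- d)) powr s * (d / (1 - exp (- d))) powr s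
      = polyexp s d * d powr s"
    using eventually_at_right_less[of "0::real"]
    by eventually_elim (simp add: powr_divide)
  ultimately show ?thesis by (simp add: tendsto_cong)
qed

section \<open>Forward differences and Abel limits at -1\<close>

text \<open>The version on reals can be differentiated, so the mean value theorem applies to its
  iterates; the version on sequences enters the power series. They are linked by
  \<open>nat_fwd_diff_powr\<close>.\<close>

abbreviation (input) real_fwd_diff :: "(real \<Rightarrow> real) \<Rightarrow> real \<Rightarrow> real" where
  "real_fwd_diff \<equiv> \<lambda>f x. f (x + 1) - f x"

abbreviation (input) nat_fwd_diff :: "(nat \<Rightarrow> real) \<Rightarrow> nat \<Rightarrow> real" where
  "nat_fwd_diff \<equiv> \<lambda>b j. b (Suc j) - b j"

lemma has_derivative_fwd_diff_powr:
  assumes "x > 0"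
  shows "((real_fwd_diff ^^ k) (\<lambda>x. x powr \<alpha>) has_real_derivative
           \<alpha> * (real_fwd_diff ^^ k) (\<lambda>x. x powr (\<alpha> - 1)) x) (at x)"
  using assms
proof (induction k arbitrary: x)
  case 0
  then show ?case by (auto intro!: derivative_eq_intros)
next
  case (Suc k)
  let ?D = "(real_fwd_diff ^^ k) (\<lambda>x. x powr \<alpha>)"
  have "((\<lambda>x. ?D (x + 1)) has_real_derivative \<alpha> * (real_fwd_diff ^^ k) (\<lambda>x. x powr (\<alpha> - 1)) (x + 1)) (at x)"
    using Suc.IH[of "x + 1"] Suc.prems by (simp add: DERIV_shift)
  from DERIV_diff[OF this Suc.IH[OF Suc.prems]] show ?case
    by (simp add: right_diff_distrib)
qed

text \<open>By the mean value theorem one further difference is \<open>\<alpha>\<close> times the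
  \<open>k\<close>-fold difference of the power \<open>\<alpha> - 1\<close> at an intermediate
  point, so the induction has to run over all exponents at once.\<close>

lemma fwd_diff_powr_bound:
  "\<exists>C. \<forall>x\<ge>1. \<bar>(real_fwd_diff ^^ k) (\<lambda>x. x powr \<alpha>) x\<bar> \<le> C * x powr (\<alpha> - real k)"
proof (induction k arbitrary: \<alpha>)
  case 0
  show ?case by (intro exI[of _ 1]) auto
next
  case (Suc k)
  let ?D = "\<lambda>\<alpha>. (real_fwd_diff ^^ k) (\<lambda>x. x powr \<alpha>)"
  obtain C where C: "\<And>x. x \<ge> 1 \<Longrightarrow> \<bar>?D (\<alpha> - 1) x\<bar> \<le> C * x powr (\<alpha> - 1 - real k)"
    using Suc.IH[of "\<alpha> - 1"] by blast
  define \<beta> where "\<beta> = \<alpha> - 1 - real k"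
  have "C \<ge> 0" using order.trans[OF abs_ge_zero C[of 1]] by simp
  show ?case
  proof (intro exI[of _ "\<bar>\<alpha>\<bar> * C * (1 + 2 powr \<beta>)"] allI impI)
    fix x :: real assume x: "x \<ge> 1"
    obtain \<xi> where \<xi>: "x < \<xi>" "\<xi> < x + 1" "?D \<alpha> (x + 1) - ?D \<alpha> x = (x + 1 - x) * (\<alpha> * ?D (\<alpha> - 1) \<xi>)"
      using MVT2[of x "x + 1" "?D \<alpha>" "\<lambda>x. \<alpha> * ?D (\<alpha> - 1) x"] has_derivative_fwd_diff_powr x by auto
    \<comment> \<open>Here \<open>x < \<xi> < 2 * x\<close>; the factor
      \<open>1 + 2 powr \<beta>\<close> covers increasing and decreasing powers together.\<close>
    have "\<xi> powr \<beta> \<le> (1 + 2 powr \<beta>) * x powr \<beta>"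
    proof (cases "\<beta> \<ge> 0")
      case True
      then have "\<xi> powr \<beta> \<le> (2 * x) powr \<beta>" using \<xi> x by (intro powr_mono2) auto
      also have "\<dots> = 2 powr \<beta> * x powr \<beta>" using x by (simp add: powr_mult)
      finally show ?thesis by (simp add: distrib_right add_increasing)
    next
      case False
      then have "\<xi> powr \<beta> \<le> x powr \<beta>" using \<xi> x by (intro powr_mono2') auto
      then show ?thesis by (simp add: distrib_right add_increasing2)
    qed
    then have "\<bar>\<alpha>\<bar> * (C * \<xi> powr \<beta>) \<le> \<bar>\<alpha>\<bar> * (C * ((1 + 2 powr \<beta>) * x powr \<beta>))"
      using \<open>C \<ge> 0\<close> by (intro mult_left_mono) auto
    moreover have "\<bar>?D (\<alpha> - 1) \<xi>\<bar> \<le> C * \<xi> powr \<beta>" unfolding \<beta>_def using \<xi> x by (intro C) auto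
    then have "\<bar>\<alpha>\<bar> * \<bar>?D (\<alpha> - 1) \<xi>\<bar> \<le> \<bar>\<alpha>\<bar> * (C * \<xi> powr \<beta>)" by (intro mult_left_mono) auto
    ultimately show "\<bar>(real_fwd_diff ^^ Suc k) (\<lambda>x. x powr \<alpha>) x\<bar> \<le> \<bar>\<alpha>\<bar> * C * (1 + 2 powr \<beta>) * x powr (\<alpha> - real (Suc k))"
      using \<xi>(3) by (simp add: abs_mult \<beta>_def algebra_simps)
  qed
qed

lemma nat_fwd_diff_powr:
  "(nat_fwd_diff ^^ k) (\<lambda>j. f (real (Suc j))) j = (real_fwd_diff ^^ k) f (real (Suc j))"
  by (induction k arbitrary: j) (simp_all add: add_ac)

text \<open>
  Each forward difference trades one power of decay for the factor \<open>1 / (1 - z)\<close>, so finitely many of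
  them reduce Abel summability at \<open>-1\<close> to absolute convergence.
\<close>

lemma powser_limit_at_minus_one:
  fixes b :: "nat \<Rightarrow> real"
  assumes "\<And>z. \<bar>z\<bar> < 1 \<Longrightarrow> summable (\<lambda>j. b j * z ^ j)"
    and "summable (\<lambda>j. \<bar>(nat_fwd_diff ^^ k) b j\<bar>)"
  shows "\<exists>L. ((\<lambda>z. \<Sum>j. b j * z ^ j) \<longlongrightarrow> L) (at_right (-1))"
  using assms
proof (induction k arbitrary: b)
  case 0
  have "((\<lambda>z. \<Sum>j. b j * z ^ j) \<longlongrightarrow> (\<Sum>j. b j * (-1) ^ j)) (at_right (-1))"
  proof (rule conjunct2[OF conjunct2[OF tannerys_theorem[where M = "\<lambda>j. \<bar>b j\<bar>"]]])
    show "((\<lambda>z. b j * z ^ j) \<longlongrightarrow> b j * (- 1) ^ j) (at_right (- 1))" for j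
      by (intro tendsto_intros)
    show "\<forall>\<^sub>F (k,x) in at_top \<times>\<^sub>F at_right (- 1). norm (b k * x ^ k) \<le> \<bar>b k\<bar>"
    proof -
      have "\<forall>\<^sub>F x in at_right (-1). \<bar>x\<bar> \<le> (1::real)"
        by (auto simp: eventually_at_right_field intro!: exI[of _ 1])
      then have "\<forall>\<^sub>F p in (at_top :: nat filter) \<times>\<^sub>F at_right (- 1). True \<and> \<bar>snd p\<bar> \<le> (1::real)"
        by (intro eventually_prodI[where P = "\<lambda>_. True"]) auto
      then show ?thesis
        by (rule eventually_mono)
          (auto simp: abs_mult power_abs intro!: mult_left_le power_le_one)
    qed
  qed (use 0 in auto)
  then show ?case by blast
next
  case (Suc k)
  let ?b = "nat_fwd_diff b"
  have shift: "summable (\<lambda>j. b (Suc j) * z ^ j)" if "\<bar>z\<bar> < 1" for z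
  proof (cases "z = 0")
    case True
    then show ?thesis by (intro summable_finite[of "{0}"]) (auto simp: power_0_left)
  next
    case False
    have "summable (\<lambda>j. b (Suc j) * z ^ Suc j)"
      using Suc.prems(1)[OF that] summable_Suc_iff[of "\<lambda>j. b j * z ^ j"] by blast
    from summable_mult[OF this, of "1 / z"] show ?thesis using False by (simp add: field_simps)
  qed
  have sb: "summable (\<lambda>j. ?b j * z ^ j)" if "\<bar>z\<bar> < 1" for z
    using summable_diff[OF shift[OF that] Suc.prems(1)[OF that]] by (simp add: algebra_simps)
  have "summable (\<lambda>j. \<bar>(nat_fwd_diff ^^ k) ?b j\<bar>)"
    using Suc.prems(2) by (simp only: funpow_Suc_right o_def)
  from Suc.IH[OF sb this] obtain L where L: "((\<lambda>z. \<Sum>j. ?b j * z ^ j) \<longlongrightarrow> L) (at_right (-1))" by blast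
  \<comment> \<open>Summation by parts: \<open>(1 - z)\<close> times the series of \<open>b\<close>
    equals \<open>b 0\<close> plus \<open>z\<close> times the series of its differences. The divisor
    \<open>1 - z\<close> tends to 2, so the limit passes from the differences to
    \<open>b\<close>.\<close>
  have "((\<lambda>z. (b 0 + z * (\<Sum>j. ?b j * z ^ j)) / (1 - z)) \<longlongrightarrow> (b 0 + (-1) * L) / (1 - (-1))) (at_right (-1))"
    by (intro tendsto_intros L) auto
  moreover have "\<forall>\<^sub>F z in at_right (-1). (b 0 + z * (\<Sum>j. ?b j * z ^ j)) / (1 - z) = (\<Sum>j. b j * z ^ j)"
  proof -
    have "\<forall>\<^sub>F x in at_right (-1). \<bar>x\<bar> < (1::real)"
      by (auto simp: eventually_at_right_field intro!: exI[of _ 1])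
    then show ?thesis
    proof eventually_elim
      case (elim z)
      define S where "S = (\<Sum>j. b (Suc j) * z ^ j)"
      define T where "T = (\<Sum>j. b j * z ^ j)"
      have "(\<Sum>j. ?b j * z ^ j) = S - T"
        unfolding S_def T_def using suminf_diff[OF shift Suc.prems(1), of z] elim by (simp add: algebra_simps)
      moreover have "T = b 0 + z * S"
      proof -
        have "T = b 0 + (\<Sum>j. b (Suc j) * z ^ Suc j)"
          unfolding T_def using suminf_split_head[OF Suc.prems(1)[OF elim]] by simp
        also have "(\<Sum>j. b (Suc j) * z ^ Suc j) = z * S"
          unfolding S_def using suminf_mult[OF shift[OF elim], of z] by (simp add: mult_ac)
        finally show ?thesis .
      qed
      moreover from this have "b 0 + z * (S - T) = (1 - z) * T" by (simp add: algebra_simps)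
      ultimately have "b 0 + z * (\<Sum>j. ?b j * z ^ j) = (1 - z) * T" by simp
      then show ?case unfolding T_def using elim by simp
    qed
  qed
  ultimately show ?case by (blast intro: Lim_transform_eventually)
qed

text \<open>The alternating sign moves the evaluation point to -1, away from the singularity at 1,
  so a finite limit exists for every real \<open>\<alpha>\<close>, including those for which the
  terms at \<open>d = 0\<close> are unbounded.\<close>

lemma alternating_polyexp_limit:
  fixes \<alpha> :: real
  shows "\<exists>L. ((\<lambda>d. \<Sum>n. real n powr \<alpha> * (- exp (- d)) ^ n) \<longlongrightarrow> L) (at_right 0)"
proof -
  \<comment> \<open>The shift keeps all arguments at least 1, where
    \<open>fwd_diff_powr_bound\<close> applies; the lost factor \<open>z\<close> is restored at the
    end.\<close>
  define b where "b = (\<lambda>j. real (Suc j) powr \<alpha>)"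
  \<comment> \<open>This many differences bring the exponent down to at most \<open>-2\<close>,
    which is summable.\<close>
  define k where "k = nat \<lceil>\<alpha> + 2\<rceil>"
  have k: "\<alpha> - real k \<le> -2" unfolding k_def by linarith
  have sb: "summable (\<lambda>j. b j * z ^ j)" if "\<bar>z\<bar> < 1" for z
  proof (cases "z = 0")
    case True
    then show ?thesis by (intro summable_finite[of "{0}"]) (auto simp: power_0_left)
  next
    case False
    have "summable (\<lambda>j. b j * z ^ Suc j)"
      using summable_powr_power[OF that, of \<alpha>] unfolding b_def
      by (subst summable_Suc_iff[of "\<lambda>j. real j powr \<alpha> * z ^ j"])
    from summable_mult[OF this, of "1 / z"] show ?thesis using False by (simp add: field_simps)
  qed
  obtain C where C: "\<And>x. x \<ge> 1 \<Longrightarrow> \<bar>(real_fwd_diff ^^ k) (\<lambda>x. x powr \<alpha>) x\<bar> \<le> C * x powr (\<alpha> - real k)"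
    using fwd_diff_powr_bound[of k \<alpha>] by blast
  have "C \<ge> 0" using order.trans[OF abs_ge_zero C[of 1]] by simp
  have "summable (\<lambda>j. \<bar>(nat_fwd_diff ^^ k) b j\<bar>)"
  proof (rule summable_comparison_test)
    show "summable (\<lambda>j. C * (1 / real (Suc j) ^ 2))"
      using inverse_power_summable[of 2, where 'a = real] summable_Suc_iff[of "\<lambda>n. inverse (real n ^ 2)"]
      by (intro summable_mult) (simp add: divide_inverse)
    have "norm \<bar>(nat_fwd_diff ^^ k) b j\<bar> \<le> C * (1 / real (Suc j) ^ 2)" for j
    proof -
      have "\<bar>(nat_fwd_diff ^^ k) b j\<bar> \<le> C * real (Suc j) powr (\<alpha> - real k)"
        unfolding b_def nat_fwd_diff_powr[of k "\<lambda>x. x powr \<alpha>"] by (intro C) auto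
      also have "\<dots> \<le> C * real (Suc j) powr (- 2)"
        using k \<open>C \<ge> 0\<close> by (intro mult_left_mono powr_mono) auto
      finally show ?thesis by (simp add: powr_minus_divide)
    qed
    then show "\<exists>N. \<forall>n\<ge>N. norm \<bar>(nat_fwd_diff ^^ k) b n\<bar> \<le> C * (1 / real (Suc n) ^ 2)" by blast
  qed
  from powser_limit_at_minus_one[OF sb this] obtain L
    where L: "((\<lambda>z. \<Sum>j. b j * z ^ j) \<longlongrightarrow> L) (at_right (-1))" by blast
  have "filterlim (\<lambda>d. - exp (- d)) (at_right (-1)) (at_right (0::real))"
    by real_asymp
  from filterlim_compose[OF L this]
  have "((\<lambda>d. - exp (- d) * (\<Sum>j. b j * (- exp (- d)) ^ j)) \<longlongrightarrow> - exp (- 0) * L) (at_right 0)"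
    by (intro tendsto_intros)
  moreover have "\<forall>\<^sub>F d in at_right 0. - exp (- d) * (\<Sum>j. b j * (- exp (- d)) ^ j)
      = (\<Sum>n. real n powr \<alpha> * (- exp (- d)) ^ n)"
    using eventually_at_right_less[of 0]
  proof eventually_elim
    case (elim d)
    define z where "z = - exp (- d)"
    have z: "\<bar>z\<bar> < 1" using elim by (simp add: z_def)
    have "(\<Sum>n. real n powr \<alpha> * z ^ n) = (\<Sum>j. b j * z ^ Suc j)"
      using suminf_split_head[OF summable_powr_power[OF z, of \<alpha>]] by (simp add: b_def)
    also have "\<dots> = z * (\<Sum>j. b j * z ^ j)"
      using suminf_mult[OF sb[OF z], of z] by (simp add: mult_ac)
    finally show ?case by (simp add: z_def)
  qed
  ultimately show ?thesis by (blast intro: Lim_transform_eventually)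
qed

text \<open>Adding the alternating series cancels the odd terms and doubles the even ones; the index
  \<open>2 * n\<close> then gives the series at \<open>2 * d\<close> with factor
  \<open>2 * 2 powr (s - 1)\<close>.\<close>

lemma polyexp_duplication:
  assumes "d > 0"
  shows "polyexp s d + (\<Sum>n. real n powr (s - 1) * (- exp (- d)) ^ n) = 2 powr s * polyexp s (2 * d)"
proof -
  define f where "f = (\<lambda>n. real n powr (s - 1) * exp (- (real n * d)) * (1 + (-1) ^ n))"
  have s1: "summable (\<lambda>n. real n powr (s - 1) * exp (- (real n * d)))"
    by (rule summable_polyexp[OF assms])
  have s2: "summable (\<lambda>n. real n powr (s - 1) * (- exp (- d)) ^ n)"
    using assms by (intro summable_powr_power) auto
  have "polyexp s d + (\<Sum>n. real n powr (s - 1) * (- exp (- d)) ^ n) = (\<Sum>n. f n)"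
    unfolding polyexp_def suminf_add[OF s1 s2] f_def
    by (intro suminf_cong) (simp add: ring_distribs power_minus[of "exp (-d)"] flip: exp_of_nat_mult)
  also have "\<dots> = (\<Sum>n. f (2 * n))"
  proof (rule suminf_mono_reindex[symmetric])
    show "strict_mono (\<lambda>n::nat. 2 * n)" by (simp add: strict_mono_def)
    fix n :: nat assume "n \<notin> range (\<lambda>n. 2 * n)"
    then have "odd n" by (auto elim: evenE)
    then show "f n = 0" by (simp add: f_def)
  qed
  also have "\<dots> = (\<Sum>n. 2 powr s * (real n powr (s - 1) * exp (- (real n * (2 * d)))))"
  proof (intro suminf_cong)
    fix n
    show "f (2 * n) = 2 powr s * (real n powr (s - 1) * exp (- (real n * (2 * d))))"
      by (simp add: f_def powr_mult powr_diff mult_ac)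
  qed
  also have "\<dots> = 2 powr s * polyexp s (2 * d)"
    unfolding polyexp_def using assms by (intro suminf_mult summable_polyexp) auto
  finally show ?thesis .
qed

text \<open>
  The error \<open>E d = polyexp s d - Gamma s * d powr (- s)\<close> satisfies
  \<open>2 powr s * E (2 * d) = E d + H d\<close>, where the alternating sum \<open>H\<close> converges at \<open>0\<close>. Iterating
  towards \<open>0\<close> contracts the error, since \<open>E d = o(d powr (- s))\<close>.
\<close>

lemma polyexp_expansion:
  assumes s: "s > 0"
  shows "\<exists>C. ((\<lambda>d. polyexp s d - Gamma s * d powr (- s)) \<longlongrightarrow> C) (at_right 0)"
proof -
  define H where "H = (\<lambda>d. \<Sum>n. real n powr (s - 1) * (- exp (- d)) ^ n)"
  obtain h where h: "(H \<longlongrightarrow> h) (at_right 0)"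
    using alternating_polyexp_limit[of "s - 1"] unfolding H_def by blast
  \<comment> \<open>The only possible limit of the error: it must satisfy
    \<open>2 powr s * c = c + h\<close>.\<close>
  define c where "c = h / (2 powr s - 1)"
  define q where "q = 2 powr (- s)"
  have q: "0 < q" "q < 1" using s by (auto simp: q_def powr_less_one)
  have p2: "2 powr s > 1" using s by simp
  define E where "E = (\<lambda>d. polyexp s d - Gamma s * d powr (- s) - c)"
  have rec: "E d = q * (E (d / 2) + (H (d / 2) - h))" if "d > 0" for d
  proof -
    have "polyexp s (d / 2) + H (d / 2) = 2 powr s * polyexp s d"
      using polyexp_duplication[of "d / 2" s] that by (simp add: H_def)
    moreover have "(d / 2) powr (- s) = 2 powr s * d powr (- s)"
      using that by (simp add: powr_divide powr_minus field_simps)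
    moreover have "c * (2 powr s - 1) = h"
      using p2 s by (simp add: c_def)
    then have "c * 2 powr s = c + h" by (simp add: algebra_simps)
    ultimately have "E (d / 2) + (H (d / 2) - h) = 2 powr s * E d"
      by (simp add: E_def algebra_simps)
    then show ?thesis using p2 by (simp add: q_def powr_minus)
  qed
  have small: "((\<lambda>d. E d * d powr s) \<longlongrightarrow> 0) (at_right 0)"
  proof -
    have "((\<lambda>d. c * d powr s) \<longlongrightarrow> 0) (at_right 0)" using s by real_asymp
    then have "((\<lambda>d. polyexp s d * d powr s - Gamma s - c * d powr s) \<longlongrightarrow> Gamma s - Gamma s - 0) (at_right 0)"
      by (intro tendsto_diff tendsto_polyexp_leading[OF s] tendsto_const)
    moreover have "\<forall>\<^sub>F d in at_right 0. polyexp s d * d powr s - Gamma s - c * d powr s = E d * d powr s"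
      using eventually_at_right_less[of 0]
      by eventually_elim (simp add: E_def algebra_simps flip: powr_add)
    ultimately show ?thesis by (simp add: tendsto_cong)
  qed
  have "(E \<longlongrightarrow> 0) (at_right 0)"
  proof (rule tendstoI)
    fix e :: real assume e: "e > 0"
    \<comment> \<open>Chosen so that \<open>q * (e / 2 + \<epsilon>) = e / 2\<close>, which makes
      the bound \<open>e / 2\<close> stable under the iteration.\<close>
    define \<epsilon> where "\<epsilon> = e * (1 - q) / (2 * q)"
    have \<epsilon>: "\<epsilon> > 0" using e q by (simp add: \<epsilon>_def)
    have "\<forall>\<^sub>F d in at_right 0. dist (H d) h < \<epsilon>" using h \<epsilon> by (rule tendstoD)
    then obtain \<eta> where \<eta>: "\<eta> > 0" "\<And>d. 0 < d \<Longrightarrow> d < \<eta> \<Longrightarrow> \<bar>H d - h\<bar> < \<epsilon>"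
      by (auto simp: eventually_at_right_field dist_real_def)
    have it: "\<bar>E d\<bar> \<le> q ^ k * \<bar>E (d / 2 ^ k)\<bar> + e / 2" if "0 < d" "d < \<eta>" for d k
      using that
    proof (induction k arbitrary: d)
      case 0
      then show ?case using e by simp
    next
      case (Suc k)
      have "\<bar>E d\<bar> \<le> q * (\<bar>E (d / 2)\<bar> + \<bar>H (d / 2) - h\<bar>)"
        unfolding rec[OF Suc.prems(1)] using q by (simp add: abs_mult abs_triangle_ineq)
      also have "\<dots> \<le> q * ((q ^ k * \<bar>E (d / 2 / 2 ^ k)\<bar> + e / 2) + \<epsilon>)"
        using Suc.IH[of "d / 2"] Suc.prems \<eta>(2)[of "d / 2"] q by (intro mult_left_mono add_mono) auto
      also have "\<dots> = q ^ Suc k * \<bar>E (d / 2 ^ Suc k)\<bar> + e / 2"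
        using q by (simp add: \<epsilon>_def field_simps)
      finally show ?case .
    qed
    have "\<bar>E d\<bar> < e" if d: "0 < d" "d < \<eta>" for d
    proof -
      \<comment> \<open>Since \<open>q ^ k\<close> is the quotient of
        \<open>(d / 2 ^ k) powr s\<close> by \<open>d powr s\<close>, the contracted error is a
        constant multiple of \<open>E x * x powr s\<close> at \<open>x = d / 2 ^ k\<close>, which
        vanishes by \<open>small\<close>.\<close>
      have "filterlim (\<lambda>k. d / 2 ^ k) (at_right 0) sequentially"
        using d by real_asymp
      from filterlim_compose[OF small this]
      have "(\<lambda>k. d powr (- s) * \<bar>E (d / 2 ^ k) * (d / 2 ^ k) powr s\<bar> + e / 2) \<longlonglongrightarrow> d powr (- s) * \<bar>0\<bar> + e / 2"
        by (intro tendsto_intros)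
      moreover have "d powr (- s) * \<bar>E (d / 2 ^ k) * (d / 2 ^ k) powr s\<bar> = q ^ k * \<bar>E (d / 2 ^ k)\<bar>" for k
      proof -
        have "q ^ k = 2 powr (- (s * real k))"
          unfolding powr_realpow[OF q(1), symmetric] by (simp add: q_def powr_powr)
        moreover have "(2 ^ k) powr s = (2::real) powr (s * real k)"
          by (simp add: powr_powr mult.commute flip: powr_realpow)
        ultimately have "(d / 2 ^ k) powr s = d powr s * q ^ k"
          using d by (simp add: powr_divide powr_minus_divide)
        moreover have "d powr (- s) * d powr s = 1" using d by (simp flip: powr_add)
        ultimately show ?thesis using q by (simp add: abs_mult mult_ac)
      qed
      ultimately have "(\<lambda>k. q ^ k * \<bar>E (d / 2 ^ k)\<bar> + e / 2) \<longlonglongrightarrow> e / 2" by simp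
      then have "\<bar>E d\<bar> \<le> e / 2"
        by (rule tendsto_lowerbound) (use it d in auto)
      then show ?thesis using e by simp
    qed
    then show "\<forall>\<^sub>F d in at_right 0. dist (E d) 0 < e"
      using \<eta>(1) by (auto simp: eventually_at_right_field)
  qed
  then have "((\<lambda>d. E d + c) \<longlongrightarrow> 0 + c) (at_right 0)" by (intro tendsto_intros)
  then show ?thesis by (auto simp: E_def)
qed

section \<open>The tilted weights\<close>

definition boltz_p :: "real \<Rightarrow> nat \<Rightarrow> real" where
  "boltz_p s j = exp (- real j * s) / (1 + exp (- real j * s))"

text \<open>The variance of one Bernoulli variable, by \<open>boltz_v_eq\<close>; the form is that
  of the variance sum in the theorem.\<close>

definition boltz_v :: "real \<Rightarrow> nat \<Rightarrow> real" where
  "boltz_v s j = exp (- real j * s) / (1 + exp (- real j * s))\<^sup>2"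

definition boltz_mean :: "(nat \<Rightarrow> nat) \<Rightarrow> nat \<Rightarrow> real \<Rightarrow> real" where
  "boltz_mean a n s = (\<Sum>j=1..n. real j * real (a j) * boltz_p s j)"

definition boltz_var :: "(nat \<Rightarrow> nat) \<Rightarrow> nat \<Rightarrow> real \<Rightarrow> real" where
  "boltz_var a n s = (\<Sum>j=1..n. (real j)\<^sup>2 * real (a j) * boltz_v s j)"

lemma boltz_p_bounds: "0 \<le> boltz_p s j" "boltz_p s j \<le> 1"
  using add_pos_pos[OF zero_less_one exp_gt_zero[of "- real j * s"]] by (auto simp: boltz_p_def divide_simps)

lemma boltz_v_eq: "boltz_v s j = boltz_p s j * (1 - boltz_p s j)"
proof -
  have "1 + exp (- real j * s) > 0" by (intro add_pos_pos) auto
  then have "1 - boltz_p s j = 1 / (1 + exp (- real j * s))"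
    by (simp add: boltz_p_def field_simps)
  then show ?thesis by (simp add: boltz_p_def boltz_v_def power2_eq_square)
qed

lemma boltz_v_nonneg: "0 \<le> boltz_v s j"
  by (simp add: boltz_v_def)

lemma boltz_v_le: "boltz_v s j \<le> exp (- real j * s)"
proof -
  have "exp (- real j * s) / (1 + exp (- real j * s))\<^sup>2 \<le> exp (- real j * s) / 1"
    using add_pos_pos[OF zero_less_one exp_gt_zero[of "- real j * s"]]
    by (intro divide_left_mono) (auto intro: one_le_power)
  then show ?thesis by (simp add: boltz_v_def)
qed

lemma boltz_v_ge:
  assumes "s \<ge> 0"
  shows "boltz_v s j \<ge> exp (- real j * s) / 4"
proof -
  have "exp (- real j * s) \<le> 1" using assms by simp
  then have "(1 + exp (- real j * s))\<^sup>2 \<le> 2\<^sup>2" by (intro power_mono) auto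
  then show ?thesis
    unfolding boltz_v_def using add_pos_pos[OF zero_less_one exp_gt_zero[of "- real j * s"]]
    by (intro divide_left_mono) auto
qed

section \<open>Moment bounds and decay under two-sided exponential growth\<close>

text \<open>The lower bound is required only from \<open>J\<close> on, so that (ii), where small
  sizes may have no types at all, is covered as well. Tilts are written \<open>ln y + d\<close>: the
  factor \<open>y ^ j\<close> cancels, and \<open>d\<close> measures the distance from the critical
  tilt.\<close>

locale exp_growth =
  fixes a :: "nat \<Rightarrow> nat" and r y D1 D2 :: real and J :: nat
  assumes r_pos: "r > 0" and y_ge_1: "y \<ge> 1" and D1_pos: "D1 > 0" and D2_pos: "D2 > 0"
    and upper: "\<And>j. j \<ge> 1 \<Longrightarrow> real (a j) \<le> D2 * real j powr (r - 1) * y ^ j"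
    and lower: "\<And>j. j \<ge> J \<Longrightarrow> D1 * real j powr (r - 1) * y ^ j \<le> real (a j)"
begin

lemma y_power_exp: "y ^ j * exp (- real j * (ln y + d)) = exp (- (real j * d))"
proof -
  have "y ^ j = exp (real j * ln y)"
    using y_ge_1 by (simp add: exp_of_nat_mult)
  then show ?thesis by (simp add: algebra_simps flip: exp_add)
qed

lemma weight_le:
  assumes "j \<ge> 1"
  shows "real (a j) * exp (- real j * (ln y + d)) \<le> D2 * (real j powr (r - 1) * exp (- (real j * d)))"
proof -
  have "real (a j) * exp (- real j * (ln y + d)) \<le> D2 * real j powr (r - 1) * y ^ j * exp (- real j * (ln y + d))"
    by (intro mult_right_mono upper assms) auto
  also have "\<dots> = D2 * (real j powr (r - 1) * (y ^ j * exp (- real j * (ln y + d))))"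
    by (simp only: mult.assoc)
  finally show ?thesis unfolding y_power_exp .
qed

lemma weight_ge:
  assumes "j \<ge> J"
  shows "real (a j) * exp (- real j * (ln y + d)) \<ge> D1 * (real j powr (r - 1) * exp (- (real j * d)))"
proof -
  have "real (a j) * exp (- real j * (ln y + d)) \<ge> D1 * real j powr (r - 1) * y ^ j * exp (- real j * (ln y + d))"
    by (intro mult_right_mono lower assms) auto
  also have "D1 * real j powr (r - 1) * y ^ j * exp (- real j * (ln y + d))
      = D1 * (real j powr (r - 1) * (y ^ j * exp (- real j * (ln y + d))))"
    by (simp only: mult.assoc)
  finally show ?thesis unfolding y_power_exp .
qed

text \<open>The truncated sums are dominated by the full series \<open>polyexp (r + k) d\<close>,
  hence the uniformity in \<open>n\<close>. Any constant above \<open>Gamma (r + k)\<close> would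
  serve as the limit bound; twice it is taken.\<close>

lemma weighted_sum_le:
  "\<exists>C>0. \<forall>\<^sub>F d in at_right 0. \<forall>n. (\<Sum>j=1..n. real j ^ k * (real (a j) * exp (- real j * (ln y + d))))
      \<le> C * d powr (- (r + real k))"
proof -
  define s where "s = r + real k"
  have s: "s > 0" using r_pos by (simp add: s_def)
  have G: "Gamma s > 0" using s by (rule Gamma_real_pos)
  have "\<forall>\<^sub>F d in at_right 0. polyexp s d * d powr s < 2 * Gamma s"
    using tendsto_polyexp_leading[OF s] G by (intro order_tendstoD) auto
  then have "\<forall>\<^sub>F d in at_right 0. \<forall>n. (\<Sum>j=1..n. real j ^ k * (real (a j) * exp (- real j * (ln y + d))))
      \<le> D2 * (2 * Gamma s) * d powr (- s)"
    using eventually_at_right_less[of 0]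
  proof eventually_elim
    case (elim d)
    show ?case
    proof
      fix n
      have "(\<Sum>j=1..n. real j ^ k * (real (a j) * exp (- real j * (ln y + d))))
          \<le> (\<Sum>j=1..n. real j ^ k * (D2 * (real j powr (r - 1) * exp (- (real j * d)))))"
        by (intro sum_mono mult_left_mono weight_le) auto
      also have "\<dots> = D2 * (\<Sum>j=1..n. real j powr (s - 1) * exp (- (real j * d)))"
        unfolding sum_distrib_left
      proof (intro sum.cong refl)
        fix j assume "j \<in> {1..n}"
        then have "real j powr (real k + (r - 1)) = real j ^ k * real j powr (r - 1)"
          by (simp add: powr_add powr_realpow)
        moreover have "s - 1 = real k + (r - 1)" by (simp add: s_def)
        ultimately have "real j powr (s - 1) = real j ^ k * real j powr (r - 1)" by metis
        then show "real j ^ k * (D2 * (real j powr (r - 1) * exp (- (real j * d))))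
            = D2 * (real j powr (s - 1) * exp (- (real j * d)))" by simp
      qed
      also have "(\<Sum>j=1..n. real j powr (s - 1) * exp (- (real j * d))) \<le> polyexp s d"
        unfolding polyexp_def using elim by (intro sum_le_suminf summable_polyexp) auto
      also have "polyexp s d \<le> 2 * Gamma s * d powr (- s)"
        using elim by (simp add: powr_minus field_simps)
      finally show "(\<Sum>j=1..n. real j ^ k * (real (a j) * exp (- real j * (ln y + d))))
          \<le> D2 * (2 * Gamma s) * d powr (- s)"
        using D2_pos by (simp add: mult.assoc)
    qed
  qed
  then show ?thesis
    unfolding s_def[symmetric] using D2_pos G by (intro exI[of _ "D2 * (2 * Gamma s)"]) auto
qed

lemma moment_le:
  "\<exists>C>0. \<forall>\<^sub>F d in at_right 0. \<forall>n. (\<Sum>j=1..n. real j ^ k * (real (a j) * boltz_v (ln y + d) j))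
      \<le> C * d powr (- (r + real k))"
proof -
  obtain C where C: "C > 0" "\<forall>\<^sub>F d in at_right 0. \<forall>n.
      (\<Sum>j=1..n. real j ^ k * (real (a j) * exp (- real j * (ln y + d)))) \<le> C * d powr (- (r + real k))"
    using weighted_sum_le[of k] by blast
  have "(\<Sum>j=1..n. real j ^ k * (real (a j) * boltz_v (ln y + d) j))
      \<le> (\<Sum>j=1..n. real j ^ k * (real (a j) * exp (- real j * (ln y + d))))" for n d
    by (intro sum_mono mult_left_mono boltz_v_le) auto
  then have "\<forall>\<^sub>F d in at_right 0. \<forall>n. (\<Sum>j=1..n. real j ^ k * (real (a j) * boltz_v (ln y + d) j))
      \<le> C * d powr (- (r + real k))"
    using C(2) by (auto elim!: eventually_mono intro: order.trans)
  then show ?thesis using C(1) by blast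
qed

text \<open>
  All lower bounds come from the component sizes in a window \<open>(N, 3 N]\<close> with \<open>N \<approx> 1 / d\<close>, where
  the weights \<open>a j * boltz_v s j\<close> have the constant order \<open>d powr (1 - r)\<close>.
\<close>

lemma window_weight_ge:
  "\<exists>c>0. \<forall>d N j. 0 < d \<and> 1 \<le> N \<and> J \<le> N \<and> real N * d \<le> 1 \<and> N < j \<and> j \<le> 3 * N \<longrightarrow>
      c * real N powr (r - 1) \<le> real (a j) * boltz_v (ln y + d) j"
proof (intro exI conjI allI impI)
  \<comment> \<open>The factor \<open>1 / 4\<close> comes from \<open>boltz_v_ge\<close>,
    \<open>exp (- 3)\<close> from \<open>j * d \<le> 3 * N * d \<le> 3\<close>, and the minimum
    treats both signs of \<open>r - 1\<close>.\<close>
  define c where "c = D1 / 4 * exp (- 3) * min 1 (3 powr (r - 1))"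
  show "c > 0" using D1_pos by (simp add: c_def)
  fix d :: real and N j :: nat
  assume A: "0 < d \<and> 1 \<le> N \<and> J \<le> N \<and> real N * d \<le> 1 \<and> N < j \<and> j \<le> 3 * N"
  have "min 1 (3 powr (r - 1)) * real N powr (r - 1) \<le> real j powr (r - 1)"
  proof (cases "r \<ge> 1")
    case True
    then have "min 1 (3 powr (r - 1)) * real N powr (r - 1) \<le> 1 * real N powr (r - 1)"
      by (intro mult_right_mono) auto
    also have "\<dots> \<le> real j powr (r - 1)" using A True by (simp add: powr_mono2)
    finally show ?thesis .
  next
    case False
    have "min 1 (3 powr (r - 1)) * real N powr (r - 1) \<le> 3 powr (r - 1) * real N powr (r - 1)"
      by (intro mult_right_mono) auto
    also have "\<dots> = (3 * real N) powr (r - 1)" by (simp add: powr_mult)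
    also have "\<dots> \<le> real j powr (r - 1)" using A False by (intro powr_mono2') auto
    finally show ?thesis .
  qed
  moreover have "exp (- 3) \<le> exp (- (real j * d))"
  proof -
    have "real j * d \<le> 3 * real N * d" using A by (intro mult_right_mono) auto
    then have "real j * d \<le> 3" using A by linarith
    then show ?thesis by simp
  qed
  ultimately have "(min 1 (3 powr (r - 1)) * real N powr (r - 1)) * exp (- 3)
      \<le> real j powr (r - 1) * exp (- (real j * d))"
    by (intro mult_mono) auto
  then have "D1 / 4 * ((min 1 (3 powr (r - 1)) * real N powr (r - 1)) * exp (- 3))
      \<le> D1 / 4 * (real j powr (r - 1) * exp (- (real j * d)))"
    using D1_pos by (intro mult_left_mono) auto
  then have "c * real N powr (r - 1) \<le> D1 * (real j powr (r - 1) * exp (- (real j * d))) / 4"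
    by (simp add: c_def mult_ac)
  also have "\<dots> \<le> real (a j) * exp (- real j * (ln y + d)) / 4"
    using A by (intro divide_right_mono weight_ge) auto
  also have "\<dots> = real (a j) * (exp (- real j * (ln y + d)) / 4)" by simp
  also have "\<dots> \<le> real (a j) * boltz_v (ln y + d) j"
    using A y_ge_1 by (intro mult_left_mono boltz_v_ge) (auto intro: add_nonneg_nonneg)
  finally show "c * real N powr (r - 1) \<le> real (a j) * boltz_v (ln y + d) j" .
qed

lemma window_exists:
  "\<forall>\<^sub>F d in at_right (0::real). \<exists>N. 1 \<le> N \<and> J \<le> N \<and> real N * d \<le> 1 \<and> 1 / (2 * d) \<le> real N"
proof -
  have "\<forall>\<^sub>F d in at_right (0::real). 1 / d \<ge> real J + 2"
    by real_asymp
  then show ?thesis using eventually_at_right_less[of "0::real"]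
  proof eventually_elim
    case (elim d)
    define N where "N = nat \<lfloor>1 / d\<rfloor>"
    have "real N \<le> 1 / d" "real N > 1 / d - 1" unfolding N_def using elim by linarith+
    moreover define z where "z = 1 / d"
    ultimately have "real N \<le> z" "real N > z - 1" "real J + 2 \<le> z" using elim by simp_all
    then have "real N \<ge> real J" "real N \<ge> 1" "real N \<ge> z / 2" by linarith+
    then have "real N \<ge> real J" "real N \<ge> 1" "real N \<ge> 1 / (2 * d)" by (simp_all add: z_def)
    moreover have "real N * d \<le> 1" using \<open>real N \<le> 1 / d\<close> elim by (simp add: field_simps)
    ultimately show ?case by (intro exI[of _ N]) (auto simp: mult.commute)
  qed
qed

lemma powr_half_inverse: "d > 0 \<Longrightarrow> (1 / (2 * d)) powr e = (1 / 2) powr e * d powr (- e)" for d e :: real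
  by (simp add: powr_divide powr_mult powr_minus_divide)

text \<open>The window has \<open>2 * N\<close> sizes, each contributing at least order
  \<open>N\<^sup>2 * N powr (r - 1)\<close>, and \<open>N\<close> is comparable to
  \<open>1 / d\<close>. The condition \<open>n * d \<ge> 3\<close> forces
  \<open>3 * N \<le> n\<close>, so the window survives the truncation.\<close>

lemma boltz_var_ge:
  "\<exists>c>0. \<forall>\<^sub>F d in at_right 0. \<forall>n. real n * d \<ge> 3 \<longrightarrow> boltz_var a n (ln y + d) \<ge> c * d powr (- (r + 2))"
proof -
  obtain c where c: "c > 0" and w: "\<And>d N j. 0 < d \<Longrightarrow> 1 \<le> N \<Longrightarrow> J \<le> N \<Longrightarrow> real N * d \<le> 1 \<Longrightarrow> N < j \<Longrightarrow> j \<le> 3 * N \<Longrightarrow>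
      c * real N powr (r - 1) \<le> real (a j) * boltz_v (ln y + d) j"
    using window_weight_ge by blast
  have "\<forall>\<^sub>F d in at_right 0. \<forall>n. real n * d \<ge> 3 \<longrightarrow>
      boltz_var a n (ln y + d) \<ge> (2 * c * (1 / 2) powr (r + 2)) * d powr (- (r + 2))"
    using window_exists eventually_at_right_less[of 0]
  proof eventually_elim
    case (elim d)
    then obtain N where N: "1 \<le> N" "J \<le> N" "real N * d \<le> 1" "1 / (2 * d) \<le> real N" by blast
    show ?case
    proof (intro allI impI)
      fix n assume n: "3 \<le> real n * d"
      have "3 * real N * d \<le> real n * d" using N(3) n by simp
      then have n3: "3 * N \<le> n" using elim by simp
      have "(2 * c * (1 / 2) powr (r + 2)) * d powr (- (r + 2)) = 2 * c * (1 / (2 * d)) powr (r + 2)"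
        using elim by (simp only: powr_half_inverse mult.assoc)
      also have "\<dots> \<le> 2 * c * real N powr (r + 2)"
        using N(4) c elim r_pos by (intro mult_left_mono powr_mono2) auto
      also have "real N powr (r + 2) = real N powr ((r - 1) + 3)" by (simp add: add.commute)
      also have "\<dots> = real N powr (r - 1) * real N ^ 3"
        unfolding powr_add using N(1) by simp
      also have "2 * c * (real N powr (r - 1) * real N ^ 3)
          = (\<Sum>j=N+1..3*N. (real N)\<^sup>2 * (c * real N powr (r - 1)))"
        by (simp add: power2_eq_square power3_eq_cube)
      also have "\<dots> \<le> (\<Sum>j=N+1..3*N. (real j)\<^sup>2 * (real (a j) * boltz_v (ln y + d) j))"
        using N elim c by (intro sum_mono mult_mono w power_mono) auto
      also have "\<dots> \<le> (\<Sum>j=1..n. (real j)\<^sup>2 * (real (a j) * boltz_v (ln y + d) j))"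
        using n3 by (intro sum_mono2) (auto simp: boltz_v_nonneg)
      finally show "(2 * c * (1 / 2) powr (r + 2)) * d powr (- (r + 2)) \<le> boltz_var a n (ln y + d)"
        by (simp add: boltz_var_def mult.assoc)
    qed
  qed
  then show ?thesis using c by (intro exI[of _ "2 * c * (1 / 2) powr (r + 2)"]) auto
qed

text \<open>On the window the weights are at least a multiple of \<open>N powr (r - 1)\<close>, and
  \<open>sum_one_minus_cos_ge\<close> supplies a further factor of order \<open>N\<close>.\<close>

lemma decay_exponent_ge:
  "\<exists>c>0. \<forall>\<^sub>F d in at_right 0. \<forall>n t. real n * d \<ge> 3 \<and> \<bar>t\<bar> \<le> pi \<longrightarrow>
      (\<Sum>j=1..n. real (a j) * boltz_v (ln y + d) j * (1 - cos (real j * t))) \<ge> c * d powr (- r) * min 1 ((t / d)\<^sup>2)"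
proof -
  obtain c where c: "c > 0" and w: "\<And>d N j. 0 < d \<Longrightarrow> 1 \<le> N \<Longrightarrow> J \<le> N \<Longrightarrow> real N * d \<le> 1 \<Longrightarrow> N < j \<Longrightarrow> j \<le> 3 * N \<Longrightarrow>
      c * real N powr (r - 1) \<le> real (a j) * boltz_v (ln y + d) j"
    using window_weight_ge by blast
  \<comment> \<open>The loss from replacing \<open>N\<close> by its lower bound
    \<open>1 / (2 * d)\<close> inside \<open>(N * t / pi)\<^sup>2\<close>; being at most 1, it can
    be moved out of the minimum.\<close>
  define k where "k = 1 / (2 * pi)\<^sup>2"
  have "1 \<le> (2 * pi)\<^sup>2" using pi_ge_two by (intro one_le_power) auto
  then have k: "k > 0" "k \<le> 1" by (auto simp: k_def)
  have "\<forall>\<^sub>F d in at_right 0. \<forall>n t. real n * d \<ge> 3 \<and> \<bar>t\<bar> \<le> pi \<longrightarrow>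
      (\<Sum>j=1..n. real (a j) * boltz_v (ln y + d) j * (1 - cos (real j * t)))
        \<ge> (c / 4 * (1 / 2) powr r * k) * d powr (- r) * min 1 ((t / d)\<^sup>2)"
    using window_exists eventually_at_right_less[of 0]
  proof eventually_elim
    case (elim d)
    then obtain N where N: "1 \<le> N" "J \<le> N" "real N * d \<le> 1" "1 / (2 * d) \<le> real N" by blast
    show ?case
    proof (intro allI impI)
      fix n t assume n: "3 \<le> real n * d \<and> \<bar>t\<bar> \<le> pi"
      have "3 * real N * d \<le> real n * d" using N(3) n by simp
      then have n3: "3 * N \<le> n" using elim by simp
      have "k * min 1 ((t / d)\<^sup>2) \<le> min 1 (k * (t / d)\<^sup>2)"
        using k by (auto simp: min_def mult_le_one)
      also have "k * (t / d)\<^sup>2 = (1 / (2 * d) * t / pi)\<^sup>2"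
        by (simp add: k_def power_divide power_mult_distrib)
      also have "\<dots> \<le> (real N * t / pi)\<^sup>2"
      proof -
        have "1 / (2 * d) * \<bar>t\<bar> / pi \<le> real N * \<bar>t\<bar> / pi"
          using N(4) by (intro divide_right_mono mult_right_mono) auto
        then have "(1 / (2 * d) * \<bar>t\<bar> / pi)\<^sup>2 \<le> (real N * \<bar>t\<bar> / pi)\<^sup>2"
          using elim by (intro power_mono) auto
        then show ?thesis by (simp add: power_divide power_mult_distrib)
      qed
      finally have m: "k * min 1 ((t / d)\<^sup>2) \<le> min 1 ((real N * t / pi)\<^sup>2)" by simp
      have "(c / 4 * (1 / 2) powr r * k) * d powr (- r) * min 1 ((t / d)\<^sup>2)
          = c / 4 * (1 / (2 * d)) powr r * (k * min 1 ((t / d)\<^sup>2))"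
        unfolding powr_half_inverse[OF elim(2)] by (simp only: mult_ac)
      also have "\<dots> \<le> c / 4 * real N powr r * min 1 ((real N * t / pi)\<^sup>2)"
        using N(4) c elim r_pos m k by (intro mult_mono powr_mono2 mult_left_mono) auto
      also have "\<dots> = c * real N powr (r - 1) * (real N / 4 * min 1 ((real N * t / pi)\<^sup>2))"
        using N(1) by (simp add: powr_diff)
      also have "\<dots> \<le> c * real N powr (r - 1) * (\<Sum>j=N+1..3*N. 1 - cos (real j * t))"
        using n N c by (intro mult_left_mono sum_one_minus_cos_ge) auto
      also have "\<dots> \<le> (\<Sum>j=N+1..3*N. real (a j) * boltz_v (ln y + d) j * (1 - cos (real j * t)))"
        unfolding sum_distrib_left using N elim by (intro sum_mono mult_right_mono w) auto
      also have "\<dots> \<le> (\<Sum>j=1..n. real (a j) * boltz_v (ln y + d) j * (1 - cos (real j * t)))"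
        using n3 by (intro sum_mono2) (auto simp: boltz_v_nonneg)
      finally show "(c / 4 * (1 / 2) powr r * k) * d powr (- r) * min 1 ((t / d)\<^sup>2)
          \<le> (\<Sum>j=1..n. real (a j) * boltz_v (ln y + d) j * (1 - cos (real j * t)))" .
    qed
  qed
  then show ?thesis using c k by (intro exI[of _ "c / 4 * (1 / 2) powr r * k"]) auto
qed

end

section \<open>The local limit law\<close>

definition boltz_char :: "(nat \<Rightarrow> nat) \<Rightarrow> nat \<Rightarrow> real \<Rightarrow> real \<Rightarrow> complex" where
  "boltz_char a n s t =
     (\<Prod>j=1..n. (of_real (1 - boltz_p s j) + of_real (boltz_p s j) * cis (real j * t)) ^ a j)"

definition boltz_moment :: "nat \<Rightarrow> (nat \<Rightarrow> nat) \<Rightarrow> nat \<Rightarrow> real \<Rightarrow> real" where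
  "boltz_moment k a n s = (\<Sum>j=1..n. real j ^ k * (real (a j) * boltz_v s j))"

lemma boltz_var_eq_moment: "boltz_var a n s = boltz_moment 2 a n s"
  by (simp add: boltz_var_def boltz_moment_def mult.assoc)

lemma boltz_moment_nonneg: "boltz_moment k a n s \<ge> 0"
  unfolding boltz_moment_def by (intro sum_nonneg) (simp add: boltz_v_nonneg)

lemma has_integral_boltz_char:
  assumes "B > 0"
  shows "((\<lambda>u. boltz_char a n s (u / B) * cis (- (real n * (u / B)))) has_integral
           of_real (2 * pi * B * exp (- (real n * s)) * selection_num a n /
             (\<Prod>j=1..n. (1 + exp (- real j * s)) ^ a j))) {-(pi * B)..pi * B}"
proof -
  define Z where "Z = (\<Prod>j=1..n. (1 + exp (- real j * s)) ^ a j)"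
  have pos: "1 + exp (- real j * s) > 0" for j by (intro add_pos_pos) auto
  have Z: "Z > 0" unfolding Z_def using pos by (intro prod_pos) auto
  have factor: "1 + (of_real (exp (- s)) * cis t) ^ j
      = of_real (1 + exp (- real j * s)) * (of_real (1 - boltz_p s j) + of_real (boltz_p s j) * cis (real j * t))"
    for t j
  proof -
    have "(1 + exp (- real j * s)) * boltz_p s j = exp (- real j * s)"
      using pos[of j] by (simp add: boltz_p_def)
    moreover from this have "(1 + exp (- real j * s)) * (1 - boltz_p s j) = 1"
      by (simp add: right_diff_distrib)
    ultimately have *: "of_real (1 + exp (- real j * s)) * (of_real (1 - boltz_p s j) + of_real (boltz_p s j) * cis (real j * t))
      = 1 + of_real (exp (- real j * s)) * cis (real j * t)"
      unfolding distrib_left mult.assoc[symmetric] of_real_mult[symmetric] by simp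
    have "(of_real (exp (- s)) * cis t) ^ j = of_real (exp (- s) ^ j) * cis (real j * t)"
      by (simp add: power_mult_distrib Complex.DeMoivre)
    also have "exp (- s) ^ j = exp (- real j * s)"
      by (simp flip: exp_of_nat_mult)
    finally show ?thesis by (simp only: *)
  qed
  have "((\<lambda>u. (\<Prod>j=1..n. (1 + (of_real (exp (- s)) * cis (u / B)) ^ j) ^ a j) * cis (- (real n * (u / B))))
           has_integral of_real (2 * pi * B * exp (- s) ^ n * selection_num a n)) {-(pi * B)..pi * B}"
    by (rule selection_num_Fourier[OF order.refl assms])
  moreover have "(\<Prod>j=1..n. (1 + (of_real (exp (- s)) * cis t) ^ j) ^ a j) = of_real Z * boltz_char a n s t" for t
    unfolding factor by (simp add: power_mult_distrib prod.distrib boltz_char_def Z_def)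
  ultimately have "((\<lambda>u. of_real Z * (boltz_char a n s (u / B) * cis (- (real n * (u / B)))))
           has_integral of_real (2 * pi * B * exp (- s) ^ n * selection_num a n)) {-(pi * B)..pi * B}"
    by (simp only: mult.assoc)
  from has_integral_mult_right[OF this, of "inverse (of_real Z)"]
  have "((\<lambda>u. boltz_char a n s (u / B) * cis (- (real n * (u / B)))) has_integral
      inverse (of_real Z) * of_real (2 * pi * B * exp (- s) ^ n * selection_num a n)) {-(pi * B)..pi * B}"
    using Z by (simp flip: mult.assoc)
  moreover have "inverse (of_real Z) * of_real (2 * pi * B * exp (- s) ^ n * selection_num a n)
      = complex_of_real (2 * pi * B * exp (- (real n * s)) * selection_num a n / Z)"
    by (simp add: divide_inverse mult_ac flip: exp_of_nat_mult)
  ultimately show ?thesis unfolding Z_def by simp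
qed

lemma norm_boltz_char_le:
  "cmod (boltz_char a n s t) \<le> exp (- (\<Sum>j=1..n. real (a j) * boltz_v s j * (1 - cos (real j * t))))"
proof -
  have "cmod (boltz_char a n s t)
      = (\<Prod>j=1..n. cmod (of_real (1 - boltz_p s j) + of_real (boltz_p s j) * cis (real j * t)) ^ a j)"
    by (simp add: boltz_char_def prod_norm[symmetric] norm_power del: of_real_diff)
  also have "\<dots> \<le> (\<Prod>j=1..n. exp (- (boltz_v s j * (1 - cos (real j * t)))) ^ a j)"
    unfolding boltz_v_eq by (intro prod_mono conjI power_mono bernoulli_char_norm_le boltz_p_bounds) auto
  also have "\<dots> = exp (- (\<Sum>j=1..n. real (a j) * boltz_v s j * (1 - cos (real j * t))))"
    by (simp add: exp_sum mult.assoc flip: exp_of_nat_mult sum_negf)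
  finally show ?thesis .
qed

text \<open>For factors of modulus at most 1 the difference of two products is at most the sum of
  the differences of the factors. So the one-variable errors simply add up, and no single factor has
  to be close to 1.\<close>

lemma boltz_char_approx:
  "cmod (boltz_char a n s t * cis (- (boltz_mean a n s * t)) - of_real (exp (- (boltz_var a n s * t\<^sup>2 / 2))))
     \<le> boltz_moment 3 a n s * \<bar>t\<bar> ^ 3 + boltz_moment 4 a n s * t ^ 4"
proof -
  define f where "f = (\<lambda>j. cis (- (boltz_p s j * (real j * t))) *
      (of_real (1 - boltz_p s j) + of_real (boltz_p s j) * cis (real j * t)))"
  define g where "g = (\<lambda>j. complex_of_real (exp (- (boltz_v s j * (real j * t)\<^sup>2 / 2))))"
  have fn: "cmod (f j) \<le> 1" for j
  proof -
    have "cmod (f j) \<le> exp (- (boltz_p s j * (1 - boltz_p s j) * (1 - cos (real j * t))))"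
      unfolding f_def norm_mult using bernoulli_char_norm_le[OF boltz_p_bounds, of s j "real j * t"] by simp
    also have "\<dots> \<le> 1" using boltz_p_bounds[of s j] by simp
    finally show ?thesis .
  qed
  have gn: "cmod (g j) \<le> 1" for j
    using boltz_v_nonneg[of s j] by (simp add: g_def)
  have "boltz_char a n s t * cis (- (boltz_mean a n s * t)) = (\<Prod>j=1..n. f j ^ a j)"
  proof -
    have "cis (- (boltz_mean a n s * t)) = (\<Prod>j=1..n. cis (- (boltz_p s j * (real j * t))) ^ a j)"
      by (simp add: boltz_mean_def cis_conv_exp sum_distrib_left sum_distrib_right exp_sum mult_ac
          flip: exp_of_nat_mult sum_negf)
    then show ?thesis
      by (simp add: boltz_char_def f_def power_mult_distrib prod.distrib mult.commute)
  qed
  moreover have "of_real (exp (- (boltz_var a n s * t\<^sup>2 / 2))) = (\<Prod>j=1..n. g j ^ a j)"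
  proof -
    have "exp (- (boltz_var a n s * t\<^sup>2 / 2)) = (\<Prod>j=1..n. exp (- (boltz_v s j * (real j * t)\<^sup>2 / 2)) ^ a j)"
      by (simp add: boltz_var_def sum_distrib_left sum_distrib_right sum_divide_distrib exp_sum mult_ac power_mult_distrib
          flip: exp_of_nat_mult sum_negf)
    then show ?thesis by (simp add: g_def)
  qed
  moreover have "cmod ((\<Prod>j=1..n. f j ^ a j) - (\<Prod>j=1..n. g j ^ a j)) \<le> (\<Sum>j=1..n. cmod (f j ^ a j - g j ^ a j))"
    using fn gn by (intro norm_prod_diff) (auto simp: norm_power intro!: power_le_one)
  moreover have "\<dots> \<le> (\<Sum>j=1..n. real (a j) * (boltz_v s j * \<bar>real j * t\<bar> ^ 3 + boltz_v s j * (real j * t) ^ 4))"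
  proof (intro sum_mono)
    fix j
    have "cmod (f j ^ a j - g j ^ a j) \<le> real (a j) * cmod (f j - g j)"
      using fn gn by (intro norm_power_diff) auto
    also have "cmod (f j - g j) \<le> boltz_v s j * \<bar>real j * t\<bar> ^ 3 + boltz_v s j * (real j * t) ^ 4"
      unfolding f_def g_def boltz_v_eq by (intro bernoulli_char_approx boltz_p_bounds)
    finally show "cmod (f j ^ a j - g j ^ a j)
        \<le> real (a j) * (boltz_v s j * \<bar>real j * t\<bar> ^ 3 + boltz_v s j * (real j * t) ^ 4)"
      by (simp add: mult_left_mono)
  qed
  moreover have "\<dots> = boltz_moment 3 a n s * \<bar>t\<bar> ^ 3 + boltz_moment 4 a n s * t ^ 4"
    unfolding boltz_moment_def sum_distrib_right sum.distrib[symmetric]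
    by (intro sum.cong refl) (simp add: abs_mult power_mult_distrib distrib_left mult_ac)
  ultimately show ?thesis by simp
qed

lemma integrable_inverse_one_plus_square: "integrable lborel (\<lambda>u::real. K * inverse (1 + u\<^sup>2))"
  using integrable_inverse_1_plus_square by (auto simp: set_integrable_def einterval_def)

lemma has_bochner_integral_gaussian:
  "has_bochner_integral lborel (\<lambda>u. complex_of_real (exp (- (u\<^sup>2 / 2)))) (of_real (sqrt (2 * pi)))"
proof -
  have "has_bochner_integral lborel (\<lambda>u. sqrt (2 * pi) * normal_density 0 1 u) (sqrt (2 * pi) * 1)"
    using integrable_normal_density[of 1 0] integral_normal_density[of 1 0]
    by (intro has_bochner_integral_mult_right) (auto simp: has_bochner_integral_iff)
  then have "has_bochner_integral lborel (\<lambda>u. exp (- (u\<^sup>2 / 2))) (sqrt (2 * pi))"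
    by (simp add: std_normal_density_def)
  then show ?thesis by (rule has_bochner_integral_of_real)
qed

text \<open>Puts the Gaussian bound into the shape \<open>K * inverse (1 + u\<^sup>2)\<close>, an
  integrable majorant that also fits the range where only a bound constant in \<open>u\<close> is
  available.\<close>

lemma exp_neg_mult_square_le:
  fixes k u :: real
  assumes "k > 0"
  shows "exp (- (k * u\<^sup>2)) \<le> max 1 (1 / k) * inverse (1 + u\<^sup>2)"
proof -
  have p: "1 + k * u\<^sup>2 > 0" "1 + u\<^sup>2 > 0" using assms by (auto intro: add_pos_nonneg)
  have "exp (- (k * u\<^sup>2)) = inverse (exp (k * u\<^sup>2))" by (rule exp_minus)
  also have "\<dots> \<le> inverse (1 + k * u\<^sup>2)"
    using p exp_ge_add_one_self[of "k * u\<^sup>2"] by (intro le_imp_inverse_le) auto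
  also have "\<dots> \<le> max 1 (1 / k) * inverse (1 + u\<^sup>2)"
  proof -
    have "u\<^sup>2 = 1 / k * (k * u\<^sup>2)" using assms by simp
    also have "\<dots> \<le> max 1 (1 / k) * (k * u\<^sup>2)" using assms by (intro mult_right_mono) auto
    finally have "1 + u\<^sup>2 \<le> max 1 (1 / k) * (1 + k * u\<^sup>2)" by (simp add: distrib_left)
    then show ?thesis using p by (simp add: field_simps)
  qed
  finally show ?thesis .
qed

section \<open>Convergence and domination of the rescaled characteristic function\<close>

context exp_growth
begin

lemma boltz_moment_ratio_tendsto_0:
  assumes d: "filterlim d (at_right 0) sequentially"
    and nd: "filterlim (\<lambda>n. real n * d n) at_top sequentially"
    and k: "k > 2"
  shows "(\<lambda>n. boltz_moment k a n (ln y + d n) / sqrt (boltz_var a n (ln y + d n)) ^ k) \<longlonglongrightarrow> 0"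
proof -
  \<comment> \<open>The exponent left after dividing \<open>d powr (- (r + k))\<close> by the
    \<open>k\<close>-th power of the standard deviation, of order
    \<open>d powr (- (r + 2) / 2)\<close>; it is positive exactly because
    \<open>k > 2\<close>.\<close>
  define e where "e = r * (real k / 2 - 1)"
  have e: "e > 0" using r_pos k by (simp add: e_def)
  obtain C where C: "C > 0" and "\<forall>\<^sub>F d in at_right 0. \<forall>n. boltz_moment k a n (ln y + d) \<le> C * d powr (- (r + real k))"
    using moment_le[of k] unfolding boltz_moment_def by blast
  from eventually_compose_filterlim[OF this(2) d]
  have E1: "\<forall>\<^sub>F n in sequentially. boltz_moment k a n (ln y + d n) \<le> C * d n powr (- (r + real k))"
    by (rule eventually_mono) auto
  obtain c where c: "c > 0" and "\<forall>\<^sub>F d in at_right 0. \<forall>n. real n * d \<ge> 3 \<longrightarrow>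
      boltz_var a n (ln y + d) \<ge> c * d powr (- (r + 2))"
    using boltz_var_ge by blast
  from eventually_compose_filterlim[OF this(2) d]
  have E2: "\<forall>\<^sub>F n in sequentially. real n * d n \<ge> 3 \<longrightarrow> boltz_var a n (ln y + d n) \<ge> c * d n powr (- (r + 2))"
    by (rule eventually_mono) auto
  have E3: "\<forall>\<^sub>F n in sequentially. real n * d n \<ge> 3"
    using nd by (simp add: filterlim_at_top)
  have E4: "\<forall>\<^sub>F n in sequentially. d n > 0"
    using eventually_compose_filterlim[OF eventually_at_right_less d] .
  have lim: "(\<lambda>n. C / sqrt c ^ k * d n powr e) \<longlonglongrightarrow> 0"
  proof -
    have "((\<lambda>d. C / sqrt c ^ k * d powr e) \<longlongrightarrow> 0) (at_right 0)" using e by real_asymp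
    from filterlim_compose[OF this d] show ?thesis .
  qed
  show ?thesis
  proof (rule tendsto_sandwich[OF _ _ tendsto_const lim])
    show "\<forall>\<^sub>F n in sequentially. 0 \<le> boltz_moment k a n (ln y + d n) / sqrt (boltz_var a n (ln y + d n)) ^ k"
      by (intro always_eventually allI divide_nonneg_nonneg zero_le_power)
        (auto simp: boltz_moment_nonneg boltz_var_eq_moment)
    show "\<forall>\<^sub>F n in sequentially. boltz_moment k a n (ln y + d n) / sqrt (boltz_var a n (ln y + d n)) ^ k
        \<le> C / sqrt c ^ k * d n powr e"
      using E1 E2 E3 E4
    proof eventually_elim
      case (elim n)
      define B where "B = sqrt (boltz_var a n (ln y + d n))"
      have "sqrt c * d n powr (- (r + 2) / 2) = sqrt (c * d n powr (- (r + 2)))"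
        by (simp add: real_sqrt_mult powr_half_sqrt[symmetric] powr_powr)
      also have "\<dots> \<le> B" unfolding B_def using elim by simp
      finally have "(sqrt c * d n powr (- (r + 2) / 2)) ^ k \<le> B ^ k"
        using c by (intro power_mono) auto
      moreover have "(sqrt c * d n powr (- (r + 2) / 2)) ^ k = sqrt c ^ k * d n powr (real k * (- (r + 2) / 2))"
        using elim by (simp add: power_mult_distrib powr_realpow[symmetric] powr_powr mult.commute)
      ultimately have B: "sqrt c ^ k * d n powr (real k * (- (r + 2) / 2)) \<le> B ^ k" by simp
      have "boltz_moment k a n (ln y + d n) / B ^ k \<le> C * d n powr (- (r + real k)) / (sqrt c ^ k * d n powr (real k * (- (r + 2) / 2)))"
        using B elim c C boltz_moment_nonneg by (intro frac_le) auto
      also have "\<dots> = C / sqrt c ^ k * (d n powr (- (r + real k)) / d n powr (real k * (- (r + 2) / 2)))"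
        by simp
      also have "d n powr (- (r + real k)) / d n powr (real k * (- (r + 2) / 2)) = d n powr e"
        by (simp add: e_def algebra_simps add_divide_distrib diff_divide_distrib flip: powr_diff)
      finally show ?case unfolding B_def .
    qed
  qed
qed

text \<open>Two regimes for \<open>t = u / B\<close>. If \<open>\<bar>t\<bar> < d\<close>, the
  exponent \<open>b * d powr (- r) * (t / d)\<^sup>2\<close> is at least
  \<open>b / C * u\<^sup>2\<close>, because
  \<open>B\<^sup>2 * d\<^sup>2 \<le> C * d powr (- r)\<close>. Otherwise it is
  \<open>b * d powr (- r)\<close>, and its exponential beats \<open>1 + u\<^sup>2\<close>, which
  grows at most like a power of \<open>1 / d\<close> on the range of integration.\<close>

lemma boltz_char_dominated:
  assumes d: "filterlim d (at_right 0) sequentially"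
    and nd: "filterlim (\<lambda>n. real n * d n) at_top sequentially"
  shows "\<exists>K. \<forall>\<^sub>F n in sequentially. boltz_var a n (ln y + d n) > 0 \<and>
      (\<forall>u. \<bar>u\<bar> \<le> pi * sqrt (boltz_var a n (ln y + d n)) \<longrightarrow>
        cmod (boltz_char a n (ln y + d n) (u / sqrt (boltz_var a n (ln y + d n)))) \<le> K * inverse (1 + u\<^sup>2))"
proof -
  obtain C where C: "C > 0" and "\<forall>\<^sub>F d in at_right 0. \<forall>n. boltz_moment 2 a n (ln y + d) \<le> C * d powr (- (r + real 2))"
    using moment_le[of 2] unfolding boltz_moment_def by blast
  from eventually_compose_filterlim[OF this(2) d]
  have E1: "\<forall>\<^sub>F n in sequentially. boltz_var a n (ln y + d n) \<le> C * d n powr (- (r + 2))"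
    by (rule eventually_mono) (auto simp: boltz_var_eq_moment)
  obtain c where c: "c > 0" and "\<forall>\<^sub>F d in at_right 0. \<forall>n. real n * d \<ge> 3 \<longrightarrow>
      boltz_var a n (ln y + d) \<ge> c * d powr (- (r + 2))"
    using boltz_var_ge by blast
  from eventually_compose_filterlim[OF this(2) d]
  have E2: "\<forall>\<^sub>F n in sequentially. real n * d n \<ge> 3 \<longrightarrow> boltz_var a n (ln y + d n) \<ge> c * d n powr (- (r + 2))"
    by (rule eventually_mono) auto
  have E3: "\<forall>\<^sub>F n in sequentially. real n * d n \<ge> 3"
    using nd by (simp add: filterlim_at_top)
  have E4: "\<forall>\<^sub>F n in sequentially. d n > 0"
    using eventually_compose_filterlim[OF eventually_at_right_less d] .
  obtain b where b: "b > 0" and "\<forall>\<^sub>F d in at_right 0. \<forall>n t. real n * d \<ge> 3 \<and> \<bar>t\<bar> \<le> pi \<longrightarrow>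
      (\<Sum>j=1..n. real (a j) * boltz_v (ln y + d) j * (1 - cos (real j * t))) \<ge> b * d powr (- r) * min 1 ((t / d)\<^sup>2)"
    using decay_exponent_ge by blast
  from eventually_compose_filterlim[OF this(2) d]
  have E5: "\<forall>\<^sub>F n in sequentially. \<forall>t. real n * d n \<ge> 3 \<and> \<bar>t\<bar> \<le> pi \<longrightarrow>
      (\<Sum>j=1..n. real (a j) * boltz_v (ln y + d n) j * (1 - cos (real j * t))) \<ge> b * d n powr (- r) * min 1 ((t / d n)\<^sup>2)"
    by (rule eventually_mono) auto
  have "\<forall>\<^sub>F d in at_right 0. (1 + pi\<^sup>2 * C * d powr (- (r + 2))) * exp (- (b * d powr (- r))) \<le> 1"
    using r_pos b C by real_asymp
  from eventually_compose_filterlim[OF this d]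
  have E6: "\<forall>\<^sub>F n in sequentially. (1 + pi\<^sup>2 * C * d n powr (- (r + 2))) * exp (- (b * d n powr (- r))) \<le> 1" .
  show ?thesis
  proof (rule exI[of _ "max 1 (1 / (b / C))"], use E1 E2 E3 E4 E5 E6 in eventually_elim, intro conjI allI impI)
    fix n :: nat and u :: real
    define B where "B = sqrt (boltz_var a n (ln y + d n))"
    assume e1: "boltz_var a n (ln y + d n) \<le> C * d n powr (- (r + 2))"
      and e2: "3 \<le> real n * d n \<longrightarrow> c * d n powr (- (r + 2)) \<le> boltz_var a n (ln y + d n)"
      and e3: "3 \<le> real n * d n" and e4: "d n > 0"
      and e5: "\<forall>t. 3 \<le> real n * d n \<and> \<bar>t\<bar> \<le> pi \<longrightarrow> b * d n powr (- r) * min 1 ((t / d n)\<^sup>2)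
          \<le> (\<Sum>j=1..n. real (a j) * boltz_v (ln y + d n) j * (1 - cos (real j * t)))"
      and e6: "(1 + pi\<^sup>2 * C * d n powr (- (r + 2))) * exp (- (b * d n powr (- r))) \<le> 1"
    have "0 < c * d n powr (- (r + 2))" using c e4 by simp
    also have "\<dots> \<le> boltz_var a n (ln y + d n)" using e2 e3 by simp
    finally show Vpos: "0 < boltz_var a n (ln y + d n)" .
    then have B: "B > 0" "B\<^sup>2 = boltz_var a n (ln y + d n)" by (simp_all add: B_def)
    assume "\<bar>u\<bar> \<le> pi * sqrt (boltz_var a n (ln y + d n))"
    then have u: "\<bar>u\<bar> \<le> pi * B" by (simp add: B_def)
    then have "\<bar>u / B\<bar> \<le> pi" using B by (simp add: field_simps)
    with e5 e3 have "b * d n powr (- r) * min 1 ((u / B / d n)\<^sup>2)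
        \<le> (\<Sum>j=1..n. real (a j) * boltz_v (ln y + d n) j * (1 - cos (real j * (u / B))))"
      by blast
    then have "cmod (boltz_char a n (ln y + d n) (u / B)) \<le> exp (- (b * d n powr (- r) * min 1 ((u / B / d n)\<^sup>2)))"
      by (intro order.trans[OF norm_boltz_char_le]) (simp only: exp_le_cancel_iff neg_le_iff_le)
    also have "\<dots> \<le> max 1 (1 / (b / C)) * inverse (1 + u\<^sup>2)"
    proof (cases "(u / B / d n)\<^sup>2 \<ge> 1")
      case True
      have "u\<^sup>2 \<le> (pi * B)\<^sup>2" using u by (metis abs_ge_zero power2_abs power_mono)
      also have "\<dots> \<le> pi\<^sup>2 * (C * d n powr (- (r + 2)))"
        unfolding power_mult_distrib B(2) using e1 by (intro mult_left_mono) auto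
      finally have "(1 + u\<^sup>2) * exp (- (b * d n powr (- r)))
          \<le> (1 + pi\<^sup>2 * C * d n powr (- (r + 2))) * exp (- (b * d n powr (- r)))"
        by (intro mult_right_mono) auto
      also note e6
      finally have "exp (- (b * d n powr (- r))) \<le> 1 * inverse (1 + u\<^sup>2)"
        by (simp add: field_simps add_pos_nonneg)
      also have "\<dots> \<le> max 1 (1 / (b / C)) * inverse (1 + u\<^sup>2)" by (intro mult_right_mono) auto
      finally show ?thesis using True by simp
    next
      case False
      have "B\<^sup>2 * (d n)\<^sup>2 \<le> C * d n powr (- (r + 2)) * (d n)\<^sup>2"
        unfolding B(2) using e1 by (intro mult_right_mono) auto
      also have "\<dots> = C * d n powr (- r)"
      proof -
        have "d n powr (- (r + 2)) * d n powr 2 = d n powr (- r)"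
          unfolding powr_add[symmetric] by simp
        then show ?thesis using e4 by simp
      qed
      finally have "u\<^sup>2 / (C * d n powr (- r)) \<le> u\<^sup>2 / (B\<^sup>2 * (d n)\<^sup>2)"
        using B(1) C e4 by (intro divide_left_mono mult_pos_pos) auto
      then have "b * d n powr (- r) * (u\<^sup>2 / (C * d n powr (- r))) \<le> b * d n powr (- r) * (u\<^sup>2 / (B\<^sup>2 * (d n)\<^sup>2))"
        using b by (intro mult_left_mono) auto
      moreover have "b * d n powr (- r) * (u\<^sup>2 / (C * d n powr (- r))) = b / C * u\<^sup>2"
        using e4 by simp
      moreover have "u\<^sup>2 / (B\<^sup>2 * (d n)\<^sup>2) = min 1 ((u / B / d n)\<^sup>2)"
        using False by (simp add: power_divide power_mult_distrib)
      ultimately have "exp (- (b * d n powr (- r) * min 1 ((u / B / d n)\<^sup>2))) \<le> exp (- (b / C * u\<^sup>2))"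
        by simp
      also have "\<dots> \<le> max 1 (1 / (b / C)) * inverse (1 + u\<^sup>2)"
        using b C by (intro exp_neg_mult_square_le) auto
      finally show ?thesis .
    qed
    finally show "cmod (boltz_char a n (ln y + d n) (u / sqrt (boltz_var a n (ln y + d n))))
        \<le> max 1 (1 / (b / C)) * inverse (1 + u\<^sup>2)"
      by (simp add: B_def)
  qed
qed

lemma boltz_var_at_top:
  assumes d: "filterlim d (at_right 0) sequentially"
    and nd: "filterlim (\<lambda>n. real n * d n) at_top sequentially"
  shows "filterlim (\<lambda>n. sqrt (boltz_var a n (ln y + d n))) at_top sequentially"
proof -
  obtain c where c: "c > 0" and "\<forall>\<^sub>F d in at_right 0. \<forall>n. real n * d \<ge> 3 \<longrightarrow>
      boltz_var a n (ln y + d) \<ge> c * d powr (- (r + 2))"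
    using boltz_var_ge by blast
  from eventually_compose_filterlim[OF this(2) d]
  have E2: "\<forall>\<^sub>F n in sequentially. real n * d n \<ge> 3 \<longrightarrow> boltz_var a n (ln y + d n) \<ge> c * d n powr (- (r + 2))"
    by (rule eventually_mono) auto
  have E3: "\<forall>\<^sub>F n in sequentially. real n * d n \<ge> 3"
    using nd by (simp add: filterlim_at_top)
  have "filterlim (\<lambda>d. c * d powr (- (r + 2))) at_top (at_right 0)"
    using c r_pos by real_asymp
  from filterlim_compose[OF this d]
  have "filterlim (\<lambda>n. boltz_var a n (ln y + d n)) at_top sequentially"
    by (rule filterlim_at_top_mono) (use E2 E3 in \<open>eventually_elim, auto\<close>)
  then show ?thesis by (rule filterlim_compose[OF sqrt_at_top])
qed

lemma local_limit:
  assumes d: "filterlim d (at_right 0) sequentially"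
    and nd: "filterlim (\<lambda>n. real n * d n) at_top sequentially"
    and mean: "(\<lambda>n. (real n - boltz_mean a n (ln y + d n)) / sqrt (boltz_var a n (ln y + d n))) \<longlonglongrightarrow> 0"
  shows "selection_num a \<sim>[sequentially]
    (\<lambda>n. exp (real n * (ln y + d n)) / sqrt (2 * pi * boltz_var a n (ln y + d n)) *
      (\<Prod>j=1..n. (1 + exp (- real j * (ln y + d n))) ^ a j))"
proof -
  define s where "s = (\<lambda>n. ln y + d n)"
  define B where "B = (\<lambda>n. sqrt (boltz_var a n (s n)))"
  define Z where "Z = (\<lambda>n. \<Prod>j=1..n. (1 + exp (- real j * s n)) ^ a j)"
  define \<Phi> where "\<Phi> = (\<lambda>n u. boltz_char a n (s n) (u / B n) * cis (- (real n * (u / B n))))"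
  define f where "f = (\<lambda>n u. indicator {-(pi * B n)..pi * B n} u *\<^sub>R \<Phi> n u)"
  obtain K where "\<forall>\<^sub>F n in sequentially. boltz_var a n (s n) > 0 \<and>
      (\<forall>u. \<bar>u\<bar> \<le> pi * B n \<longrightarrow> cmod (boltz_char a n (s n) (u / B n)) \<le> K * inverse (1 + u\<^sup>2))"
    using boltz_char_dominated[OF d nd] unfolding s_def B_def by blast
  then obtain N where Vpos: "\<And>n. n \<ge> N \<Longrightarrow> boltz_var a n (s n) > 0"
    and dom: "\<And>n u. n \<ge> N \<Longrightarrow> \<bar>u\<bar> \<le> pi * B n \<Longrightarrow> cmod (boltz_char a n (s n) (u / B n)) \<le> K * inverse (1 + u\<^sup>2)"
    unfolding eventually_sequentially by blast
  have B_top: "filterlim B at_top sequentially"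
    unfolding B_def s_def by (rule boltz_var_at_top[OF d nd])
  have Bpos: "B n > 0" if "n \<ge> N" for n using Vpos[OF that] by (simp add: B_def)
  \<comment> \<open>Needed for the majorant outside the interval, where \<open>f\<close> is
    0.\<close>
  have K: "K \<ge> 0"
  proof -
    have "0 \<le> K * inverse (1 + 0\<^sup>2)"
      by (rule order.trans[OF norm_ge_zero dom[of N 0]]) (use Bpos[of N] in auto)
    then show ?thesis by simp
  qed
  have cont: "continuous_on S (\<Phi> n)" for n S
    unfolding \<Phi>_def boltz_char_def divide_inverse by (intro continuous_intros)
  have int: "(LBINT u. f n u) = of_real (2 * pi * B n * exp (- (real n * s n)) * selection_num a n / Z n)"
    if "n \<ge> N" for n
  proof -
    have "set_integrable lborel {-(pi * B n)..pi * B n} (\<Phi> n)"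
      by (intro borel_integrable_atLeastAtMost' cont)
    from set_borel_integral_eq_integral(2)[OF this]
    have "(LBINT u. f n u) = integral {-(pi * B n)..pi * B n} (\<Phi> n)"
      unfolding f_def set_lebesgue_integral_def .
    also have "\<dots> = of_real (2 * pi * B n * exp (- (real n * s n)) * selection_num a n / Z n)"
      unfolding \<Phi>_def Z_def by (intro integral_unique has_integral_boltz_char Bpos that)
    finally show ?thesis .
  qed
  have point: "(\<lambda>n. f n u) \<longlonglongrightarrow> of_real (exp (- (u\<^sup>2 / 2)))" for u
  proof -
    define M where "M = (\<lambda>n. boltz_mean a n (s n))"
    have "(\<lambda>n. boltz_char a n (s n) (u / B n) * cis (- (M n * (u / B n))) - of_real (exp (- (u\<^sup>2 / 2)))) \<longlonglongrightarrow> 0"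
    proof (rule Lim_null_comparison)
      have "(\<lambda>n. boltz_moment 3 a n (s n) / B n ^ 3 * \<bar>u\<bar> ^ 3 + boltz_moment 4 a n (s n) / B n ^ 4 * u ^ 4)
          \<longlonglongrightarrow> 0 * \<bar>u\<bar> ^ 3 + 0 * u ^ 4"
        unfolding B_def s_def by (intro tendsto_intros boltz_moment_ratio_tendsto_0 d nd) auto
      then show "(\<lambda>n. boltz_moment 3 a n (s n) / B n ^ 3 * \<bar>u\<bar> ^ 3 + boltz_moment 4 a n (s n) / B n ^ 4 * u ^ 4) \<longlonglongrightarrow> 0"
        by simp
      show "\<forall>\<^sub>F n in sequentially. cmod (boltz_char a n (s n) (u / B n) * cis (- (M n * (u / B n))) - of_real (exp (- (u\<^sup>2 / 2))))
          \<le> boltz_moment 3 a n (s n) / B n ^ 3 * \<bar>u\<bar> ^ 3 + boltz_moment 4 a n (s n) / B n ^ 4 * u ^ 4"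
        using eventually_ge_at_top[of N]
      proof eventually_elim
        case (elim n)
        have "boltz_var a n (s n) * (u / B n)\<^sup>2 = u\<^sup>2"
          using Vpos[OF elim] by (simp add: B_def power_divide)
        then show ?case
          using boltz_char_approx[of a n "s n" "u / B n"] Bpos[OF elim]
          by (simp add: M_def power_divide)
      qed
    qed
    then have g: "(\<lambda>n. boltz_char a n (s n) (u / B n) * cis (- (M n * (u / B n)))) \<longlonglongrightarrow> of_real (exp (- (u\<^sup>2 / 2)))"
      by (simp add: LIM_zero_iff)
    \<comment> \<open>An inexact mean only contributes this phase factor, which tends to 1 when the
      deviation is small compared with \<open>B\<close>.\<close>
    have shift: "(\<lambda>n. cis (- ((real n - M n) / B n) * u)) \<longlonglongrightarrow> cis (- 0 * u)"
      unfolding M_def B_def s_def by (intro tendsto_intros mean)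
    have "(\<lambda>n. \<Phi> n u) \<longlonglongrightarrow> of_real (exp (- (u\<^sup>2 / 2)))"
    proof -
      have "\<Phi> n u = boltz_char a n (s n) (u / B n) * cis (- (M n * (u / B n))) * cis (- ((real n - M n) / B n) * u)" for n
      proof -
        have "- (M n * (u / B n)) + - ((real n - M n) / B n) * u = - (real n * (u / B n))"
          by (simp add: diff_divide_distrib algebra_simps)
        then show ?thesis by (simp add: \<Phi>_def mult.assoc cis_mult)
      qed
      with tendsto_mult[OF g shift] show ?thesis by simp
    qed
    moreover have "\<forall>\<^sub>F n in sequentially. \<Phi> n u = f n u"
    proof -
      have "\<forall>\<^sub>F n in sequentially. B n \<ge> \<bar>u\<bar> / pi"
        using B_top by (simp add: filterlim_at_top)
      then show ?thesis
        by eventually_elim (auto simp: f_def indicator_def field_simps abs_le_iff)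
    qed
    ultimately show ?thesis by (rule Lim_transform_eventually)
  qed
  \<comment> \<open>The majorant holds from \<open>N\<close> on, whereas dominated convergence asks
    for it at every index.\<close>
  have "(\<lambda>n. LBINT u. f (n + N) u) \<longlonglongrightarrow> (LBINT u. complex_of_real (exp (- (u\<^sup>2 / 2))))"
  proof (rule integral_dominated_convergence)
    show "integrable lborel (\<lambda>u. K * inverse (1 + u\<^sup>2))" by (rule integrable_inverse_one_plus_square)
    show "(\<lambda>u. complex_of_real (exp (- (u\<^sup>2 / 2)))) \<in> borel_measurable lborel" by measurable
    show "f (n + N) \<in> borel_measurable lborel" for n
      unfolding f_def using borel_measurable_continuous_onI[OF cont[of UNIV "n + N"]] by measurable
    show "AE u in lborel. (\<lambda>n. f (n + N) u) \<longlonglongrightarrow> of_real (exp (- (u\<^sup>2 / 2)))"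
      by (intro AE_I2 LIMSEQ_ignore_initial_segment point)
    show "AE u in lborel. norm (f (n + N) u) \<le> K * inverse (1 + u\<^sup>2)" for n
    proof (intro AE_I2)
      fix u :: real
      show "norm (f (n + N) u) \<le> K * inverse (1 + u\<^sup>2)"
      proof (cases "\<bar>u\<bar> \<le> pi * B (n + N)")
        case True
        then show ?thesis using dom[of "n + N" u] K by (auto simp: f_def \<Phi>_def norm_mult indicator_def)
      next
        case False
        then show ?thesis using K by (auto simp: f_def indicator_def)
      qed
    qed
  qed
  then have "(\<lambda>n. complex_of_real (2 * pi * B (n + N) * exp (- (real (n + N) * s (n + N))) * selection_num a (n + N) / Z (n + N)))
      \<longlonglongrightarrow> of_real (sqrt (2 * pi))"
    unfolding has_bochner_integral_integral_eq[OF has_bochner_integral_gaussian] by (subst (asm) int) auto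
  then have "(\<lambda>n. 2 * pi * B (n + N) * exp (- (real (n + N) * s (n + N))) * selection_num a (n + N) / Z (n + N))
      \<longlonglongrightarrow> sqrt (2 * pi)"
    by (simp only: tendsto_of_real_iff)
  then have "(\<lambda>n. 2 * pi * B n * exp (- (real n * s n)) * selection_num a n / Z n) \<longlonglongrightarrow> sqrt (2 * pi)"
    by (rule LIMSEQ_offset)
  then have lim: "(\<lambda>n. 2 * pi * B n * exp (- (real n * s n)) * selection_num a n / Z n / sqrt (2 * pi)) \<longlonglongrightarrow> sqrt (2 * pi) / sqrt (2 * pi)"
    by (intro tendsto_intros) auto
  show ?thesis
  proof (rule asymp_equivI')
    have "\<forall>\<^sub>F n in sequentially. 2 * pi * B n * exp (- (real n * s n)) * selection_num a n / Z n / sqrt (2 * pi)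
        = selection_num a n / (exp (real n * s n) / sqrt (2 * pi * boltz_var a n (s n)) * Z n)"
    \<comment> \<open>The identity holds for every \<open>n\<close>: where the variance is 0, both
      sides are 0 because \<open>x / 0 = 0\<close>.\<close>
    proof (intro always_eventually allI)
      fix n
      have "2 * pi / sqrt (2 * pi) = sqrt (2 * pi)" by (simp add: real_div_sqrt)
      then have "2 * pi / sqrt (2 * pi) * B n = sqrt (2 * pi * boltz_var a n (s n))"
        by (simp only: B_def real_sqrt_mult[of "2 * pi"])
      then have "2 * pi * B n / sqrt (2 * pi) = sqrt (2 * pi * boltz_var a n (s n))"
        by simp
      then show "2 * pi * B n * exp (- (real n * s n)) * selection_num a n / Z n / sqrt (2 * pi)
        = selection_num a n / (exp (real n * s n) / sqrt (2 * pi * boltz_var a n (s n)) * Z n)"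
        by (simp add: exp_minus divide_simps mult_ac)
    qed
    then show "((\<lambda>n. selection_num a n / (exp (real n * (ln y + d n)) / sqrt (2 * pi * boltz_var a n (ln y + d n)) *
      (\<Prod>j=1..n. (1 + exp (- real j * (ln y + d n))) ^ a j))) \<longlongrightarrow> 1) sequentially"
      using lim unfolding s_def Z_def by (simp add: tendsto_cong)
  qed
qed

end

section \<open>The exact saddle point\<close>

lemma boltz_p_eq: "boltz_p s j = 1 / (1 + exp (real j * s))"
  by (simp add: boltz_p_def exp_minus field_simps)

lemma boltz_p_antimono:
  assumes "s \<le> t"
  shows "boltz_p t j \<le> boltz_p s j"
proof -
  have "exp (real j * s) \<le> exp (real j * t)" using assms by (simp add: mult_left_mono)
  then show ?thesis unfolding boltz_p_eq by (intro divide_left_mono mult_pos_pos add_pos_pos) auto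
qed

lemma boltz_mean_antimono: "s \<le> t \<Longrightarrow> boltz_mean a n t \<le> boltz_mean a n s"
  unfolding boltz_mean_def by (intro sum_mono mult_left_mono boltz_p_antimono) auto

context exp_growth
begin

text \<open>If \<open>\<sigma> n < ln y + C / n\<close>, the exponential damping of every size up to
  \<open>n\<close> is at least \<open>exp (- C)\<close>. The sizes above \<open>n / 2\<close> alone
  then push the mean to order \<open>n powr (r + 1)\<close>, beyond \<open>n\<close>. This also
  excludes tilts at or below \<open>ln y\<close>, which the truncated equation does not forbid by
  itself.\<close>

lemma saddle_point_times_n_at_top:
  assumes saddle: "\<forall>\<^sub>F n in sequentially. boltz_mean a n (\<sigma> n) = real n"
  shows "filterlim (\<lambda>n. real n * (\<sigma> n - ln y)) at_top sequentially"
  unfolding filterlim_at_top_gt[where c = 0]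
proof (intro allI impI)
  fix C :: real assume C: "C > 0"
  have "\<forall>\<^sub>F n in sequentially. real n / 2 * ((real n / 2) powr r * (D1 * exp (- C) / 2)) > real n"
    using r_pos D1_pos by real_asymp
  \<comment> \<open>Places the upper half of the sizes beyond \<open>J\<close>, where the lower
    bound for \<open>a\<close> holds.\<close>
  moreover have "\<forall>\<^sub>F n in sequentially. n \<ge> 2 * J + 1" by (rule eventually_ge_at_top)
  ultimately show "\<forall>\<^sub>F n in sequentially. C \<le> real n * (\<sigma> n - ln y)"
    using saddle
  proof eventually_elim
    case (elim n)
    show ?case
    proof (rule ccontr)
      assume "\<not> C \<le> real n * (\<sigma> n - ln y)"
      define t where "t = ln y + C / real n"
      have n: "n > 0" using elim by simp
      have "\<sigma> n \<le> t"
        using \<open>\<not> C \<le> real n * (\<sigma> n - ln y)\<close> n by (simp add: t_def field_simps)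
      have t: "t \<ge> 0" using y_ge_1 C by (simp add: t_def)
      have "real n / 2 * ((real n / 2) powr r * (D1 * exp (- C) / 2))
          \<le> real (n - n div 2) * ((real n / 2) powr r * (D1 * exp (- C) / 2))"
        using D1_pos by (intro mult_right_mono) auto
      also have "\<dots> = (\<Sum>j=n div 2 + 1..n. (real n / 2) powr r * (D1 * exp (- C) / 2))"
        by simp
      also have "\<dots> \<le> (\<Sum>j=n div 2 + 1..n. real j * real (a j) * boltz_p t j)"
      proof (intro sum_mono)
        fix j assume j: "j \<in> {n div 2 + 1..n}"
        then have j': "j \<ge> J" "j > 0" "real j \<ge> real n / 2" "real j \<le> real n" using elim by auto
        have "(real n / 2) powr r * (D1 * exp (- C) / 2) \<le> real j powr r * (D1 * exp (- (real j * (C / real n))) / 2)"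
        proof (intro mult_mono powr_mono2 divide_right_mono mult_left_mono)
          have "real j * C \<le> real n * C" using j' C by (intro mult_right_mono) auto
          then show "exp (- C) \<le> exp (- (real j * (C / real n)))" using n by (simp add: field_simps)
        qed (use j' r_pos D1_pos in auto)
        also have "\<dots> = real j * (D1 * (real j powr (r - 1) * exp (- (real j * (C / real n))))) / 2"
          using j' by (simp add: powr_diff)
        also have "\<dots> \<le> real j * (real (a j) * exp (- real j * t)) / 2"
          unfolding t_def by (intro divide_right_mono mult_left_mono weight_ge j') auto
        also have "\<dots> = real j * real (a j) * (exp (- real j * t) / 2)" by simp
        also have "\<dots> \<le> real j * real (a j) * boltz_p t j"
        proof (intro mult_left_mono)
          have "exp (- real j * t) \<le> 1" using t by simp
          then show "exp (- real j * t) / 2 \<le> boltz_p t j"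
            unfolding boltz_p_def by (intro divide_left_mono) (auto intro: add_pos_pos)
        qed auto
        finally show "(real n / 2) powr r * (D1 * exp (- C) / 2) \<le> real j * real (a j) * boltz_p t j" .
      qed
      also have "\<dots> \<le> boltz_mean a n t"
        unfolding boltz_mean_def by (intro sum_mono2) (auto simp: boltz_p_bounds)
      also have "\<dots> \<le> boltz_mean a n (\<sigma> n)"
        by (intro boltz_mean_antimono \<open>\<sigma> n \<le> t\<close>)
      finally show False using elim by simp
    qed
  qed
qed

text \<open>At any fixed \<open>d > 0\<close> for which \<open>weighted_sum_le\<close> holds, the
  means are bounded uniformly in \<open>n\<close>. By monotonicity a tilt staying above
  \<open>ln y + d\<close> could not have mean \<open>n\<close>. Positivity follows from the growth
  of \<open>n * (\<sigma> n - ln y)\<close>.\<close>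

lemma saddle_point_at_right:
  assumes saddle: "\<forall>\<^sub>F n in sequentially. boltz_mean a n (\<sigma> n) = real n"
  shows "filterlim (\<lambda>n. \<sigma> n - ln y) (at_right 0) sequentially"
proof -
  have pos: "\<forall>\<^sub>F n in sequentially. \<sigma> n - ln y > 0"
  proof -
    have "\<forall>\<^sub>F n in sequentially. real n * (\<sigma> n - ln y) \<ge> 1"
      using saddle_point_times_n_at_top[OF saddle] by (simp add: filterlim_at_top)
    then show ?thesis
    proof eventually_elim
      case (elim n)
      then have "real n * (\<sigma> n - ln y) > 0" by linarith
      then show ?case by (simp add: zero_less_mult_iff)
    qed
  qed
  have "(\<lambda>n. \<sigma> n - ln y) \<longlonglongrightarrow> 0"
  proof (rule tendstoI)
    fix \<epsilon> :: real assume \<epsilon>: "\<epsilon> > 0"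
    obtain C where "\<forall>\<^sub>F d in at_right 0. \<forall>n. (\<Sum>j=1..n. real j ^ 1 * (real (a j) * exp (- real j * (ln y + d))))
        \<le> C * d powr (- (r + real 1))"
      using weighted_sum_le[of 1] by blast
    moreover have "\<forall>\<^sub>F d in at_right 0. d < \<epsilon>" using \<epsilon> by (auto simp: eventually_at_right_field)
    ultimately have "\<forall>\<^sub>F d in at_right 0. d < \<epsilon> \<and> (\<forall>n. (\<Sum>j=1..n. real j ^ 1 * (real (a j) * exp (- real j * (ln y + d))))
        \<le> C * d powr (- (r + real 1)))"
      by eventually_elim auto
    then obtain d where d: "d < \<epsilon>" and
      W: "\<And>n. (\<Sum>j=1..n. real j * (real (a j) * exp (- real j * (ln y + d)))) \<le> C * d powr (- (r + 1))"
      using eventually_happens'[of "at_right (0::real)"] by fastforce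
    have "\<forall>\<^sub>F n in sequentially. real n > C * d powr (- (r + 1))"
      using filterlim_real_sequentially by (simp add: filterlim_at_top_dense)
    then show "\<forall>\<^sub>F n in sequentially. dist (\<sigma> n - ln y) 0 < \<epsilon>"
      using saddle pos
    proof eventually_elim
      case (elim n)
      have "\<sigma> n - ln y < \<epsilon>"
      proof (rule ccontr)
        assume "\<not> \<sigma> n - ln y < \<epsilon>"
        then have "ln y + d \<le> \<sigma> n" using d by simp
        then have "boltz_mean a n (\<sigma> n) \<le> boltz_mean a n (ln y + d)" by (rule boltz_mean_antimono)
        also have "\<dots> \<le> (\<Sum>j=1..n. real j * (real (a j) * exp (- real j * (ln y + d))))"
          unfolding boltz_mean_def mult.assoc
        proof (intro sum_mono mult_left_mono)
          fix j
          have "exp (- real j * (ln y + d)) / (1 + exp (- real j * (ln y + d))) \<le> exp (- real j * (ln y + d)) / 1"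
            by (intro divide_left_mono) (auto intro: add_pos_pos)
          then show "boltz_p (ln y + d) j \<le> exp (- real j * (ln y + d))" by (simp add: boltz_p_def)
        qed auto
        finally show False using W[of n] elim by simp
      qed
      then show ?case using elim by simp
    qed
  qed
  then show ?thesis using pos by (auto simp: filterlim_at elim: eventually_mono)
qed

lemma saddle_point_asymptotics:
  assumes saddle: "\<forall>\<^sub>F n in sequentially. boltz_mean a n (\<sigma> n) = real n"
  shows "selection_num a \<sim>[sequentially]
    (\<lambda>n. exp (real n * \<sigma> n) / sqrt (2 * pi * boltz_var a n (\<sigma> n)) * (\<Prod>j=1..n. (1 + exp (- real j * \<sigma> n)) ^ a j))"
proof -
  have "(\<lambda>n. (real n - boltz_mean a n (\<sigma> n)) / sqrt (boltz_var a n (\<sigma> n))) \<longlonglongrightarrow> 0"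
    by (rule tendsto_eventually) (use saddle in eventually_elim, simp)
  then show ?thesis
    using local_limit[OF saddle_point_at_right[OF saddle] saddle_point_times_n_at_top[OF saddle]]
    by simp
qed

end

section \<open>The explicit tilt\<close>

text \<open>Tannery's theorem when summands and upper limit move together: terms beyond
  \<open>n\<close> are set to 0, which keeps the majorant and affects no termwise limit.\<close>

lemma tendsto_truncated_sum:
  fixes f :: "nat \<Rightarrow> nat \<Rightarrow> real"
  assumes lim: "\<And>j. j \<ge> 1 \<Longrightarrow> (\<lambda>n. f n j) \<longlonglongrightarrow> g j"
    and bound: "\<forall>\<^sub>F n in sequentially. \<forall>j\<ge>1. \<bar>f n j\<bar> \<le> h j"
    and h: "summable h"
  shows "\<exists>L. (\<lambda>n. \<Sum>j=1..n. f n j) \<longlonglongrightarrow> L"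
proof -
  define F where "F = (\<lambda>j n. if 1 \<le> j \<and> j \<le> n then f n j else 0)"
  define G where "G = (\<lambda>j. if 1 \<le> j then g j else 0)"
  have "(\<lambda>n. F j n) \<longlonglongrightarrow> G j" for j
  proof (cases "j \<ge> 1")
    case True
    have "\<forall>\<^sub>F n in sequentially. f n j = F j n"
      using eventually_ge_at_top[of j] by eventually_elim (use True in \<open>simp add: F_def\<close>)
    then show ?thesis using lim[OF True] True by (auto simp: G_def elim: Lim_transform_eventually)
  qed (simp add: F_def G_def)
  moreover have "\<forall>\<^sub>F (j, n) in at_top \<times>\<^sub>F sequentially. norm (F j n) \<le> h j"
  proof -
    have "\<forall>\<^sub>F p in (at_top :: nat filter) \<times>\<^sub>F sequentially. fst p \<ge> 1 \<and> (\<forall>j\<ge>1. \<bar>f (snd p) j\<bar> \<le> h j)"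
      using bound by (intro eventually_prodI[where P = "\<lambda>j. j \<ge> 1"]) (auto simp: eventually_ge_at_top)
    then show ?thesis
      by (rule eventually_mono) (auto simp: F_def intro: order.trans[OF abs_ge_zero])
  qed
  ultimately have "(\<lambda>n. \<Sum>j. F j n) \<longlonglongrightarrow> (\<Sum>j. G j)"
    using h by (intro conjunct2[OF conjunct2[OF tannerys_theorem[where M = h]]]) auto
  moreover have "(\<Sum>j. F j n) = (\<Sum>j=1..n. f n j)" for n
  proof -
    have "(\<Sum>j. F j n) = (\<Sum>j\<in>{1..n}. F j n)"
      by (rule suminf_finite) (auto simp: F_def)
    also have "\<dots> = (\<Sum>j=1..n. f n j)" by (intro sum.cong) (auto simp: F_def)
    finally show ?thesis .
  qed
  ultimately show ?thesis by auto
qed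

text \<open>For \<open>j > n\<close> half of the exponential decay is given up:
  \<open>exp (- j * d) \<le> exp (- n * d / 2) * exp (- j * d / 2)\<close>.\<close>

lemma polyexp_tail_le:
  assumes "d > 0"
  shows "\<bar>polyexp s d - (\<Sum>j=1..n. real j powr (s - 1) * exp (- (real j * d)))\<bar> \<le> exp (- (real n * d / 2)) * polyexp s (d / 2)"
proof -
  define f where "f = (\<lambda>j. real j powr (s - 1) * exp (- (real j * d)))"
  define g where "g = (\<lambda>j. real j powr (s - 1) * exp (- (real j * (d / 2))))"
  have sf: "summable f" and sg: "summable g"
    unfolding f_def g_def using assms by (intro summable_polyexp; simp)+
  have "(\<Sum>j=1..n. f j) = (\<Sum>j<Suc n. f j)"
  proof -
    have "{..<Suc n} = insert 0 {1..n}" by auto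
    moreover have "f 0 = 0" by (simp add: f_def)
    ultimately show ?thesis by simp
  qed
  then have eq: "polyexp s d - (\<Sum>j=1..n. f j) = (\<Sum>j. f (j + Suc n))"
    using suminf_minus_initial_segment[OF sf, of "Suc n"] by (simp add: polyexp_def f_def)
  have "(\<Sum>j. f (j + Suc n)) \<le> (\<Sum>j. exp (- (real n * d / 2)) * g (j + Suc n))"
  proof (intro suminf_le allI)
    fix j
    have "exp (- (real (j + Suc n) * d)) \<le> exp (- (real n * d / 2)) * exp (- (real (j + Suc n) * (d / 2)))"
    proof -
      have "real n * d / 2 \<le> real (j + Suc n) * d / 2" using assms by (intro divide_right_mono mult_right_mono) auto
      then show ?thesis unfolding exp_add[symmetric] by simp
    qed
    then show "f (j + Suc n) \<le> exp (- (real n * d / 2)) * g (j + Suc n)"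
      unfolding f_def g_def by (subst mult.left_commute) (intro mult_left_mono, auto)
  qed (use summable_ignore_initial_segment[OF sf, of "Suc n"] summable_ignore_initial_segment[OF sg, of "Suc n"]
      in \<open>auto intro: summable_mult\<close>)
  also have "\<dots> = exp (- (real n * d / 2)) * (\<Sum>j. g (j + Suc n))"
    by (rule suminf_mult[OF summable_ignore_initial_segment[OF sg]])
  also have "\<dots> \<le> exp (- (real n * d / 2)) * (\<Sum>j. g j)"
  proof (intro mult_left_mono)
    have "(\<Sum>j<Suc n. g j) \<ge> 0" by (intro sum_nonneg) (simp add: g_def)
    then show "(\<Sum>j. g (j + Suc n)) \<le> (\<Sum>j. g j)"
      using suminf_minus_initial_segment[OF sg, of "Suc n"] by simp
  qed simp
  finally have "(\<Sum>j. f (j + Suc n)) \<le> exp (- (real n * d / 2)) * polyexp s (d / 2)"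
    by (simp add: polyexp_def g_def)
  moreover have "(\<Sum>j. f (j + Suc n)) \<ge> 0"
    by (intro suminf_nonneg summable_ignore_initial_segment[OF sf]) (simp add: f_def)
  ultimately show ?thesis using eq unfolding f_def by simp
qed

lemma eventually_bound_imp_bound:
  fixes f g :: "nat \<Rightarrow> real"
  assumes "\<forall>\<^sub>F j in sequentially. \<bar>f j\<bar> \<le> c * g j" and g: "\<And>j. j \<ge> 1 \<Longrightarrow> g j > 0"
  shows "\<exists>C>0. \<forall>j\<ge>1. \<bar>f j\<bar> \<le> C * g j"
proof -
  obtain N where N: "\<And>j. j \<ge> N \<Longrightarrow> \<bar>f j\<bar> \<le> c * g j"
    using assms(1) unfolding eventually_sequentially by blast
  define C where "C = 1 + \<bar>c\<bar> + (\<Sum>j<N. \<bar>f j / g j\<bar>)"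
  have nn: "(\<Sum>j<N. \<bar>f j / g j\<bar>) \<ge> 0" by (intro sum_nonneg) auto
  have "\<bar>f j\<bar> \<le> C * g j" if j: "j \<ge> 1" for j
  proof (cases "j < N")
    case True
    have "\<bar>f j / g j\<bar> \<le> (\<Sum>j<N. \<bar>f j / g j\<bar>)" using True by (intro member_le_sum) auto
    then have "\<bar>f j\<bar> / g j \<le> C" using g[OF j] by (simp add: C_def abs_divide)
    then show ?thesis using g[OF j] by (simp add: field_simps)
  next
    case False
    then have "\<bar>f j\<bar> \<le> c * g j" by (intro N) auto
    also have "\<dots> \<le> C * g j" using g[OF j] nn by (intro mult_right_mono) (auto simp: C_def)
    finally show ?thesis .
  qed
  moreover have "C > 0" using nn by (simp add: C_def)
  ultimately show ?thesis by blast
qed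

text \<open>The common constant 2 is dictated by \<open>x / (1 + x)\<^sup>2\<close>, whose expansion
  starts with \<open>x - 2 * x\<^sup>2\<close>; mean, variance and logarithm can then share one
  expansion lemma.\<close>

lemma div_one_plus_approx:
  fixes x :: real
  assumes "0 \<le> x"
  shows "\<bar>x / (1 + x) - x\<bar> \<le> 2 * x\<^sup>2"
proof -
  have "x / (1 + x) - x = - (x\<^sup>2 / (1 + x))" using assms by (simp add: field_simps power2_eq_square)
  moreover have "x\<^sup>2 / (1 + x) \<le> x\<^sup>2 / 1" using assms by (intro divide_left_mono) auto
  then have "x\<^sup>2 / (1 + x) \<le> x\<^sup>2" by simp
  moreover have "x\<^sup>2 / (1 + x) \<ge> 0" using assms by simp
  ultimately show ?thesis using zero_le_power2[of x] by linarith
qed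

lemma div_one_plus_square_approx:
  fixes x :: real
  assumes "0 \<le> x"
  shows "\<bar>x / (1 + x)\<^sup>2 - x\<bar> \<le> 2 * x\<^sup>2"
proof -
  have p: "(1 + x)\<^sup>2 > 0" using assms by simp
  have "x * (1 + x)\<^sup>2 - x \<le> 2 * x\<^sup>2 * (1 + x)\<^sup>2"
  proof -
    have "2 * x\<^sup>2 * (1 + x)\<^sup>2 - (x * (1 + x)\<^sup>2 - x) = 3 * x ^ 3 + 2 * x ^ 4"
      by (simp add: power2_eq_square eval_nat_numeral algebra_simps)
    then show ?thesis using assms by (smt (verit) zero_le_power mult_nonneg_nonneg)
  qed
  then have "x - x / (1 + x)\<^sup>2 \<le> 2 * x\<^sup>2" using p by (simp add: field_simps)
  moreover have "x / (1 + x)\<^sup>2 \<le> x / 1" using assms by (intro divide_left_mono) (auto intro: one_le_power)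
  ultimately show ?thesis by simp
qed

lemma tendsto_imp_abs_bounded:
  fixes f :: "nat \<Rightarrow> real"
  assumes "f \<longlonglongrightarrow> L"
  shows "\<exists>C. \<forall>n. \<bar>f n\<bar> \<le> C"
  using convergent_imp_Bseq[OF convergentI[OF assms]] by (auto simp: Bseq_def)

text \<open>
  The saddle point is replaced by the explicit \<open>\<delta> n\<close> with
  \<open>K * Gamma (r + 1) * \<delta> n powr (- (r + 1)) = n\<close>; the local limit law tolerates the bounded error in the mean.
\<close>

locale explicit_growth =
  fixes a :: "nat \<Rightarrow> nat" and K r y \<nu> :: real
  assumes K_pos: "K > 0" and r_pos: "r > 0" and y_gt_1: "y > 1" and \<nu>_less: "\<nu> < 1"
    and err: "(\<lambda>j. real (a j) - K * real j powr (r - 1) * y ^ j) \<in> O(\<lambda>j. y powr (\<nu> * real j))"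
begin

definition G :: real where "G = K * Gamma (r + 1)"

definition \<delta> :: "nat \<Rightarrow> real" where "\<delta> n = (G / real n) powr (1 / (r + 1))"

lemma G_pos: "G > 0"
  unfolding G_def using K_pos r_pos by (intro mult_pos_pos Gamma_real_pos) auto

lemma \<delta>_pos: "n > 0 \<Longrightarrow> \<delta> n > 0"
  using G_pos by (simp add: \<delta>_def)

lemma n_eq_\<delta>:
  assumes "n > 0"
  shows "real n = G * \<delta> n powr (- (r + 1))"
proof -
  have "1 / (r + 1) * (- (r + 1)) = - 1" using r_pos by (simp add: divide_simps)
  then have "\<delta> n powr (- (r + 1)) = (G / real n) powr (- 1)"
    by (simp only: \<delta>_def powr_powr)
  then show ?thesis using G_pos assms by (simp add: powr_minus_divide)
qed

lemma \<delta>_at_right: "filterlim \<delta> (at_right 0) sequentially"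
proof -
  have "filterlim (\<lambda>n. (G / real n) powr (1 / (r + 1))) (at_right 0) sequentially"
    using G_pos r_pos by real_asymp
  then show ?thesis by (simp add: \<delta>_def[abs_def])
qed

lemma n_\<delta>_at_top: "filterlim (\<lambda>n. real n * \<delta> n) at_top sequentially"
proof -
  have "filterlim (\<lambda>d. G * d powr (- (r + 1)) * d) at_top (at_right 0)"
    using G_pos r_pos by real_asymp
  from filterlim_compose[OF this \<delta>_at_right]
  have "filterlim (\<lambda>n. G * \<delta> n powr (- (r + 1)) * \<delta> n) at_top sequentially" .
  moreover have ev: "\<forall>\<^sub>F n in sequentially. G * \<delta> n powr (- (r + 1)) * \<delta> n = real n * \<delta> n"
    using eventually_gt_at_top[of 0] by eventually_elim (simp only: n_eq_\<delta>[symmetric])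
  ultimately show ?thesis using filterlim_cong[OF refl refl ev] by blast
qed

lemma err_bound: "\<exists>C>0. \<forall>j\<ge>1. \<bar>real (a j) - K * real j powr (r - 1) * y ^ j\<bar> \<le> C * y powr (\<nu> * real j)"
proof -
  obtain c where "\<forall>\<^sub>F j in sequentially. \<bar>real (a j) - K * real j powr (r - 1) * y ^ j\<bar> \<le> c * y powr (\<nu> * real j)"
    using err by (elim landau_o.bigE) (auto simp: abs_of_pos)
  from eventually_bound_imp_bound[OF this] show ?thesis using y_gt_1 by auto
qed

text \<open>As \<open>\<nu> < 1\<close> and \<open>y > 1\<close>, the error is exponentially smaller
  than the main term: eventually it is at most half of it, and for all \<open>j \<ge> 1\<close> at
  most a constant multiple. This makes the local limit law available for (ii).\<close>

lemma growth_bounds: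
  "\<exists>D2 J. exp_growth a r y (K / 2) D2 J"
proof -
  obtain C where C: "C > 0" and e: "\<And>j. j \<ge> 1 \<Longrightarrow> \<bar>real (a j) - K * real j powr (r - 1) * y ^ j\<bar> \<le> C * y powr (\<nu> * real j)"
    using err_bound by blast
  have ev: "\<forall>\<^sub>F j in sequentially. y powr (\<nu> * real j) \<le> \<epsilon> * (real j powr (r - 1) * y ^ j)" if "\<epsilon> > 0" for \<epsilon>
  proof -
    have "\<forall>\<^sub>F j in sequentially. exp (\<nu> * ln y * real j) \<le> \<epsilon> * (real j powr (r - 1) * exp (ln y * real j))"
    proof -
      define l where "l = (1 - \<nu>) * ln y"
      have "l > 0" using \<nu>_less y_gt_1 by (simp add: l_def)
      then have "\<forall>\<^sub>F j in sequentially. exp (- l * real j) \<le> \<epsilon> * real j powr (r - 1)"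
        using that by real_asymp
      then show ?thesis
      proof eventually_elim
        case (elim j)
        then have "exp (- l * real j) * exp (ln y * real j) \<le> \<epsilon> * real j powr (r - 1) * exp (ln y * real j)"
          by (intro mult_right_mono) auto
        moreover have "exp (- l * real j) * exp (ln y * real j) = exp (\<nu> * ln y * real j)"
          unfolding exp_add[symmetric] by (simp add: l_def algebra_simps)
        ultimately show ?case by (metis mult.assoc)
      qed
    qed
    then show ?thesis
    proof eventually_elim
      case (elim j)
      have "y powr (\<nu> * real j) = exp (\<nu> * ln y * real j)" "y ^ j = exp (ln y * real j)"
        using y_gt_1 by (simp_all add: powr_def mult_ac flip: powr_realpow)
      with elim show ?case by simp
    qed
  qed
  have "\<exists>H>0. \<forall>j\<ge>1. \<bar>y powr (\<nu> * real j)\<bar> \<le> H * (real j powr (r - 1) * y ^ j)"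
    using ev[of 1] y_gt_1 by (intro eventually_bound_imp_bound[of _ 1]) auto
  then obtain H where H: "H > 0" and H': "\<And>j. j \<ge> 1 \<Longrightarrow> y powr (\<nu> * real j) \<le> H * (real j powr (r - 1) * y ^ j)"
    by auto
  obtain J where J: "\<And>j. j \<ge> J \<Longrightarrow> y powr (\<nu> * real j) \<le> K / (2 * C) * (real j powr (r - 1) * y ^ j)"
    using ev[of "K / (2 * C)"] K_pos C unfolding eventually_sequentially by auto
  have "exp_growth a r y (K / 2) (K + C * H) (max 1 J)"
  proof
    fix j :: nat assume "j \<ge> 1"
    have "real (a j) \<le> K * real j powr (r - 1) * y ^ j + C * y powr (\<nu> * real j)"
      using e[OF \<open>j \<ge> 1\<close>] by linarith
    also have "\<dots> \<le> K * real j powr (r - 1) * y ^ j + C * (H * (real j powr (r - 1) * y ^ j))"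
      using H'[OF \<open>j \<ge> 1\<close>] C by simp
    finally show "real (a j) \<le> (K + C * H) * real j powr (r - 1) * y ^ j"
      by (simp add: algebra_simps)
  next
    fix j :: nat assume j: "j \<ge> max 1 J"
    have "C * y powr (\<nu> * real j) \<le> C * (K / (2 * C) * (real j powr (r - 1) * y ^ j))"
      using J[of j] j C by (intro mult_left_mono) auto
    also have "\<dots> = K / 2 * real j powr (r - 1) * y ^ j" using C by simp
    finally show "K / 2 * real j powr (r - 1) * y ^ j \<le> real (a j)"
      using e[of j] j by (simp add: abs_le_iff)
  qed (use K_pos r_pos y_gt_1 C H in \<open>auto intro!: add_pos_pos\<close>)
  then show ?thesis by blast
qed

section \<open>Expansions along the explicit tilt\<close>

text \<open>Since \<open>n * \<delta> n = G * \<delta> n powr (- r)\<close>, the tail factor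
  \<open>exp (- n * \<delta> n / 2)\<close> beats the growth \<open>\<delta> n powr (- s)\<close> of
  the series.\<close>

lemma truncated_polyexp:
  assumes s: "s > 0"
  shows "(\<lambda>n. (\<Sum>j=1..n. real j powr (s - 1) * exp (- (real j * \<delta> n))) - polyexp s (\<delta> n)) \<longlonglongrightarrow> 0"
proof (rule Lim_null_comparison)
  have "((\<lambda>d. polyexp s d * d powr s) \<longlongrightarrow> Gamma s) (at_right 0)"
    by (rule tendsto_polyexp_leading[OF s])
  moreover have "filterlim (\<lambda>d. d / 2) (at_right 0) (at_right (0::real))" by real_asymp
  ultimately have "((\<lambda>d. polyexp s (d / 2) * (d / 2) powr s) \<longlongrightarrow> Gamma s) (at_right 0)"
    by (rule filterlim_compose)
  moreover have "((\<lambda>d. exp (- (G * d powr (- (r + 1)) * d / 2)) * (d / 2) powr (- s)) \<longlongrightarrow> 0) (at_right (0::real))"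
    using G_pos r_pos by real_asymp
  ultimately have "((\<lambda>d. polyexp s (d / 2) * (d / 2) powr s * (exp (- (G * d powr (- (r + 1)) * d / 2)) * (d / 2) powr (- s)))
      \<longlongrightarrow> Gamma s * 0) (at_right 0)"
    by (rule tendsto_mult)
  from filterlim_compose[OF this \<delta>_at_right]
  have "(\<lambda>n. polyexp s (\<delta> n / 2) * (\<delta> n / 2) powr s * (exp (- (G * \<delta> n powr (- (r + 1)) * \<delta> n / 2)) * (\<delta> n / 2) powr (- s)))
      \<longlonglongrightarrow> 0" by simp
  moreover have "\<forall>\<^sub>F n in sequentially.
      polyexp s (\<delta> n / 2) * (\<delta> n / 2) powr s * (exp (- (G * \<delta> n powr (- (r + 1)) * \<delta> n / 2)) * (\<delta> n / 2) powr (- s))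
      = exp (- (real n * \<delta> n / 2)) * polyexp s (\<delta> n / 2)"
    using eventually_gt_at_top[of 0]
  proof eventually_elim
    case (elim n)
    have "(\<delta> n / 2) powr s * (\<delta> n / 2) powr (- s) = 1"
      using \<delta>_pos[OF elim] by (simp flip: powr_add)
    moreover have "polyexp s (\<delta> n / 2) * (\<delta> n / 2) powr s * (E * (\<delta> n / 2) powr (- s))
        = E * polyexp s (\<delta> n / 2) * ((\<delta> n / 2) powr s * (\<delta> n / 2) powr (- s))" for E
      by (simp only: mult_ac)
    ultimately have "polyexp s (\<delta> n / 2) * (\<delta> n / 2) powr s * (E * (\<delta> n / 2) powr (- s)) = E * polyexp s (\<delta> n / 2)" for E
      by simp
    then show ?case unfolding n_eq_\<delta>[OF elim, symmetric] by blast
  qed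
  ultimately show "(\<lambda>n. exp (- (real n * \<delta> n / 2)) * polyexp s (\<delta> n / 2)) \<longlonglongrightarrow> 0"
    by (rule Lim_transform_eventually)
  show "\<forall>\<^sub>F n in sequentially. norm ((\<Sum>j=1..n. real j powr (s - 1) * exp (- (real j * \<delta> n))) - polyexp s (\<delta> n))
      \<le> exp (- (real n * \<delta> n / 2)) * polyexp s (\<delta> n / 2)"
    using eventually_gt_at_top[of 0]
  proof eventually_elim
    case (elim n)
    then show ?case using polyexp_tail_le[OF \<delta>_pos[OF elim], of s n] by (simp add: abs_minus_commute)
  qed
qed

text \<open>Two replacements lead to a multiple of \<open>polyexp\<close>: \<open>\<phi> x\<close>
  by \<open>x\<close>, with error at most \<open>2 * x\<^sup>2\<close>, and \<open>a j\<close> by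
  its main term. Both errors have a summable majorant independent of \<open>n\<close>, so their sums
  converge; what remains is expanded by \<open>polyexp_expansion\<close>.\<close>

lemma weighted_sum_expansion:
  fixes \<phi> :: "real \<Rightarrow> real" and k :: nat
  assumes \<phi>: "\<And>x. 0 \<le> x \<Longrightarrow> x \<le> 1 \<Longrightarrow> \<bar>\<phi> x - x\<bar> \<le> 2 * x\<^sup>2"
    and cont: "\<And>x. 0 < x \<Longrightarrow> isCont \<phi> x"
  shows "\<exists>L. (\<lambda>n. (\<Sum>j=1..n. real j ^ k * (real (a j) * \<phi> (exp (- real j * (ln y + \<delta> n)))))
      - K * Gamma (r + real k) * \<delta> n powr (- (r + real k))) \<longlonglongrightarrow> L"
proof -
  define s where "s = r + real k"
  have s: "s > 0" using r_pos by (simp add: s_def)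
  obtain D2 J where "exp_growth a r y (K / 2) D2 J" using growth_bounds by blast
  then interpret exp_growth a r y "K / 2" D2 J .
  obtain C where C: "C > 0" and e: "\<And>j. j \<ge> 1 \<Longrightarrow> \<bar>real (a j) - K * real j powr (r - 1) * y ^ j\<bar> \<le> C * y powr (\<nu> * real j)"
    using err_bound by blast
  define x where "x = (\<lambda>n j. exp (- real j * (ln y + \<delta> n)))"
  define f where "f = (\<lambda>n j. real j ^ k * (real (a j) * \<phi> (x n j) - K * real j powr (r - 1) * exp (- (real j * \<delta> n))))"
  \<comment> \<open>The first part bounds the nonlinear error, as
    \<open>a j * (x n j)\<^sup>2\<close> is at most of order
    \<open>j powr (r - 1) * y ^ j * y powr (- 2 * j)\<close>; the second bounds the error of
    \<open>a j\<close> times \<open>x n j \<le> (1 / y) ^ j\<close>.\<close>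
  define h where "h = (\<lambda>j. 2 * D2 * (real j powr (s - 1) * (1 / y) ^ j) + C * (real j powr (real k) * (y powr (\<nu> - 1)) ^ j))"
  have pos: "\<forall>\<^sub>F n in sequentially. \<delta> n > 0"
    using eventually_gt_at_top[of 0] by eventually_elim (rule \<delta>_pos)
  have "\<exists>L. (\<lambda>n. \<Sum>j=1..n. f n j) \<longlonglongrightarrow> L"
  proof (rule tendsto_truncated_sum)
    show "summable h"
      unfolding h_def using y_gt_1 \<nu>_less
      by (intro summable_add summable_mult summable_powr_power) (auto simp: powr_less_one)
    fix j :: nat
    have "\<delta> \<longlonglongrightarrow> 0" using \<delta>_at_right by (simp add: filterlim_at)
    then show "(\<lambda>n. f n j) \<longlonglongrightarrow> real j ^ k * (real (a j) * \<phi> (exp (- real j * (ln y + 0))) - K * real j powr (r - 1) * exp (- (real j * 0)))"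
      unfolding f_def x_def by (intro tendsto_intros isCont_tendsto_compose[OF cont]) auto
  next
    show "\<forall>\<^sub>F n in sequentially. \<forall>j\<ge>1. \<bar>f n j\<bar> \<le> h j"
      using pos
    proof eventually_elim
      case (elim n)
      show ?case
      proof (intro allI impI)
        fix j :: nat assume j: "j \<ge> 1"
        have x0: "x n j > 0" by (simp add: x_def)
        have xy: "x n j \<le> (1 / y) ^ j"
        proof -
          have "x n j \<le> exp (- real j * ln y)" unfolding x_def using elim by (simp add: algebra_simps)
          also have "\<dots> = (1 / y) ^ j" using y_gt_1
            by (simp add: exp_minus exp_of_nat_mult power_inverse divide_inverse)
          finally show ?thesis .
        qed
        also have "(1 / y) ^ j \<le> 1" using y_gt_1 by (intro power_le_one) auto
        finally have x1: "x n j \<le> 1" .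
        have yj: "y ^ j * (1 / y) ^ j = 1" using y_gt_1 by (simp flip: power_mult_distrib)
        have 1: "\<bar>real (a j) * \<phi> (x n j) - real (a j) * x n j\<bar> \<le> 2 * D2 * (real j powr (r - 1) * (1 / y) ^ j)"
        proof -
          have "\<bar>real (a j) * \<phi> (x n j) - real (a j) * x n j\<bar> = real (a j) * \<bar>\<phi> (x n j) - x n j\<bar>"
            by (simp add: abs_mult flip: right_diff_distrib)
          also have "\<dots> \<le> (D2 * real j powr (r - 1) * y ^ j) * (2 * ((1 / y) ^ j)\<^sup>2)"
          proof (intro mult_mono upper j)
            have "\<bar>\<phi> (x n j) - x n j\<bar> \<le> 2 * (x n j)\<^sup>2" using x0 x1 by (intro \<phi>) auto
            also have "\<dots> \<le> 2 * ((1 / y) ^ j)\<^sup>2" using x0 xy by (intro mult_left_mono power_mono) auto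
            finally show "\<bar>\<phi> (x n j) - x n j\<bar> \<le> 2 * ((1 / y) ^ j)\<^sup>2" .
          qed (use D2_pos y_gt_1 in auto)
          also have "\<dots> = 2 * D2 * (real j powr (r - 1) * (1 / y) ^ j) * (y ^ j * (1 / y) ^ j)"
            by (simp only: power2_eq_square mult_ac)
          finally show ?thesis unfolding yj by simp
        qed
        have 2: "\<bar>real (a j) * x n j - K * real j powr (r - 1) * exp (- (real j * \<delta> n))\<bar> \<le> C * (y powr (\<nu> - 1)) ^ j"
        proof -
          have "real (a j) * x n j - K * real j powr (r - 1) * exp (- (real j * \<delta> n))
              = (real (a j) - K * real j powr (r - 1) * y ^ j) * x n j"
          proof -
            have "exp (- (real j * \<delta> n)) = y ^ j * x n j" by (simp only: y_power_exp x_def)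
            then show ?thesis by (simp add: algebra_simps)
          qed
          then have "\<bar>real (a j) * x n j - K * real j powr (r - 1) * exp (- (real j * \<delta> n))\<bar>
              = \<bar>real (a j) - K * real j powr (r - 1) * y ^ j\<bar> * x n j"
            using x0 by (simp add: abs_mult)
          also have "\<dots> \<le> (C * y powr (\<nu> * real j)) * (1 / y) ^ j"
            using e[OF j] xy x0 C by (intro mult_mono) auto
          also have "y powr (\<nu> * real j) = (y powr \<nu>) ^ j"
            using y_gt_1 by (simp add: powr_powr flip: powr_realpow)
          also have "C * (y powr \<nu>) ^ j * (1 / y) ^ j = C * (y powr (\<nu> - 1)) ^ j"
            using y_gt_1 by (simp add: powr_diff power_divide)
          finally show ?thesis .
        qed
        have "\<bar>f n j\<bar> = real j ^ k * \<bar>real (a j) * \<phi> (x n j) - K * real j powr (r - 1) * exp (- (real j * \<delta> n))\<bar>"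
          by (simp add: f_def abs_mult)
        also have "\<dots> \<le> real j ^ k * (2 * D2 * (real j powr (r - 1) * (1 / y) ^ j) + C * (y powr (\<nu> - 1)) ^ j)"
          using 1 2 by (intro mult_left_mono) (linarith, simp)
        also have "\<dots> = h j"
        proof -
          have "real j powr (real k + (r - 1)) = real j ^ k * real j powr (r - 1)"
            using j by (simp add: powr_add powr_realpow)
          moreover have "s - 1 = real k + (r - 1)" by (simp add: s_def)
          ultimately have "real j powr (s - 1) = real j ^ k * real j powr (r - 1)" by metis
          then show ?thesis using j by (simp add: h_def powr_realpow distrib_left mult_ac)
        qed
        finally show "\<bar>f n j\<bar> \<le> h j" .
      qed
    qed
  qed
  then obtain L1 where L1: "(\<lambda>n. \<Sum>j=1..n. f n j) \<longlonglongrightarrow> L1" by blast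
  obtain L2 where "((\<lambda>d. polyexp s d - Gamma s * d powr (- s)) \<longlongrightarrow> L2) (at_right 0)"
    using polyexp_expansion[OF s] by blast
  from filterlim_compose[OF this \<delta>_at_right]
  have L2: "(\<lambda>n. polyexp s (\<delta> n) - Gamma s * \<delta> n powr (- s)) \<longlonglongrightarrow> L2" .
  have "(\<lambda>n. (\<Sum>j=1..n. f n j) + K * (((\<Sum>j=1..n. real j powr (s - 1) * exp (- (real j * \<delta> n))) - polyexp s (\<delta> n))
        + (polyexp s (\<delta> n) - Gamma s * \<delta> n powr (- s)))) \<longlonglongrightarrow> L1 + K * (0 + L2)"
    by (intro tendsto_add tendsto_mult tendsto_const L1 L2 truncated_polyexp[OF s])
  moreover have "(\<Sum>j=1..n. f n j) + K * (((\<Sum>j=1..n. real j powr (s - 1) * exp (- (real j * \<delta> n))) - polyexp s (\<delta> n))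
        + (polyexp s (\<delta> n) - Gamma s * \<delta> n powr (- s)))
      = (\<Sum>j=1..n. real j ^ k * (real (a j) * \<phi> (x n j))) - K * Gamma s * \<delta> n powr (- s)" for n
  proof -
    have "(\<Sum>j=1..n. f n j) + K * (\<Sum>j=1..n. real j powr (s - 1) * exp (- (real j * \<delta> n)))
        = (\<Sum>j=1..n. real j ^ k * (real (a j) * \<phi> (x n j)))"
      unfolding sum_distrib_left sum.distrib[symmetric]
    proof (intro sum.cong refl)
      fix j assume "j \<in> {1..n}"
      then have "real j powr (real k + (r - 1)) = real j ^ k * real j powr (r - 1)"
        by (simp add: powr_add powr_realpow)
      moreover have "s - 1 = real k + (r - 1)" by (simp add: s_def)
      ultimately have "real j powr (s - 1) = real j ^ k * real j powr (r - 1)" by metis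
      then show "f n j + K * (real j powr (s - 1) * exp (- (real j * \<delta> n))) = real j ^ k * (real (a j) * \<phi> (x n j))"
        by (simp add: f_def algebra_simps)
    qed
    then show ?thesis by (simp add: algebra_simps)
  qed
  ultimately show ?thesis unfolding x_def s_def by auto
qed

lemma mean_expansion:
  "\<exists>C. \<forall>\<^sub>F n in sequentially. \<bar>real n - boltz_mean a n (ln y + \<delta> n)\<bar> \<le> C"
proof -
  obtain L where L: "(\<lambda>n. (\<Sum>j=1..n. real j ^ 1 * (real (a j) *
        (exp (- real j * (ln y + \<delta> n)) / (1 + exp (- real j * (ln y + \<delta> n))))))
      - K * Gamma (r + real 1) * \<delta> n powr (- (r + real 1))) \<longlonglongrightarrow> L"
    using weighted_sum_expansion[of "\<lambda>x. x / (1 + x)" 1] div_one_plus_approx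
    by (auto intro!: continuous_intros)
  from tendsto_imp_abs_bounded[OF this] obtain C where
    C: "\<And>n. \<bar>(\<Sum>j=1..n. real j ^ 1 * (real (a j) *
        (exp (- real j * (ln y + \<delta> n)) / (1 + exp (- real j * (ln y + \<delta> n))))))
      - K * Gamma (r + real 1) * \<delta> n powr (- (r + real 1))\<bar> \<le> C" by blast
  have "\<forall>\<^sub>F n in sequentially. \<bar>real n - boltz_mean a n (ln y + \<delta> n)\<bar> \<le> C"
    using eventually_gt_at_top[of 0]
  proof eventually_elim
    case (elim n)
    have "K * Gamma (r + real 1) * \<delta> n powr (- (r + real 1)) = real n"
      using n_eq_\<delta>[OF elim] by (simp add: G_def)
    moreover have "(\<Sum>j=1..n. real j ^ 1 * (real (a j) *
        (exp (- real j * (ln y + \<delta> n)) / (1 + exp (- real j * (ln y + \<delta> n)))))) = boltz_mean a n (ln y + \<delta> n)"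
      by (simp only: boltz_mean_def boltz_p_def power_one_right mult.assoc)
    ultimately show ?case using C[of n] by (metis abs_minus_commute)
  qed
  then show ?thesis by blast
qed

lemma var_asymp:
  "(\<lambda>n. boltz_var a n (ln y + \<delta> n) * \<delta> n powr (r + 2)) \<longlonglongrightarrow> K * Gamma (r + 2)"
proof -
  obtain L where L: "(\<lambda>n. (\<Sum>j=1..n. real j ^ 2 * (real (a j) *
        (exp (- real j * (ln y + \<delta> n)) / (1 + exp (- real j * (ln y + \<delta> n)))\<^sup>2)))
      - K * Gamma (r + real 2) * \<delta> n powr (- (r + real 2))) \<longlonglongrightarrow> L"
    using weighted_sum_expansion[of "\<lambda>x. x / (1 + x)\<^sup>2" 2] div_one_plus_square_approx
    by (auto intro!: continuous_intros)
  have "((\<lambda>d. d powr (r + 2)) \<longlongrightarrow> 0) (at_right 0)" using r_pos by real_asymp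
  from filterlim_compose[OF this \<delta>_at_right]
  have "(\<lambda>n. \<delta> n powr (r + 2)) \<longlonglongrightarrow> 0" .
  from tendsto_add[OF tendsto_mult[OF L this] tendsto_const[of "K * Gamma (r + 2)"]]
  have "(\<lambda>n. (boltz_var a n (ln y + \<delta> n) - K * Gamma (r + 2) * \<delta> n powr (- (r + 2))) * \<delta> n powr (r + 2)
      + K * Gamma (r + 2)) \<longlonglongrightarrow> K * Gamma (r + 2)"
    by (simp add: boltz_var_def boltz_v_def mult.assoc)
  moreover have "\<forall>\<^sub>F n in sequentially. (boltz_var a n (ln y + \<delta> n) - K * Gamma (r + 2) * \<delta> n powr (- (r + 2))) * \<delta> n powr (r + 2)
      + K * Gamma (r + 2) = boltz_var a n (ln y + \<delta> n) * \<delta> n powr (r + 2)"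
    using eventually_gt_at_top[of 0]
  proof eventually_elim
    case (elim n)
    have "\<delta> n powr (- (r + 2)) * \<delta> n powr (r + 2) = 1"
      using \<delta>_pos[OF elim] unfolding powr_add[symmetric] by simp
    then show ?case by (simp add: left_diff_distrib mult.assoc)
  qed
  ultimately show ?thesis by (rule Lim_transform_eventually)
qed

text \<open>This quantity is exponentiated, so its limit must be reached with additive error
  \<open>o(1)\<close>; \<open>exp L\<close> becomes a factor of \<open>\<kappa>1\<close>.\<close>

lemma log_partition_expansion:
  "\<exists>L. (\<lambda>n. (\<Sum>j=1..n. real (a j) * ln (1 + exp (- real j * (ln y + \<delta> n)))) - K * Gamma r * \<delta> n powr (- r)) \<longlonglongrightarrow> L"
proof -
  have "\<bar>ln (1 + x) - x\<bar> \<le> 2 * x\<^sup>2" if "0 \<le> x" "x \<le> 1" for x :: real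
    using abs_ln_one_plus_x_minus_x_bound_nonneg[OF that] zero_le_power2[of x] by linarith
  moreover have "isCont (\<lambda>x. ln (1 + x)) x" if "0 < x" for x :: real
    using that by (intro continuous_intros) auto
  ultimately show ?thesis
    using weighted_sum_expansion[of "\<lambda>x. ln (1 + x)" 0] by simp
qed

lemma explicit_asymptotics:
  "\<exists>\<kappa>1>0. selection_num a \<sim>[sequentially]
     (\<lambda>n. \<kappa>1 * y ^ n * real n powr (- ((r + 2) / (2 * (r + 1)))) *
        exp ((r + 1) / r * (K * Gamma (r + 1)) powr (1 / (r + 1)) * real n powr (r / (r + 1))))"
proof -
  obtain D2 J where "exp_growth a r y (K / 2) D2 J" using growth_bounds by blast
  then interpret exp_growth a r y "K / 2" D2 J .
  define V where "V = (\<lambda>n. boltz_var a n (ln y + \<delta> n))"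
  define S where "S = (\<lambda>n. \<Sum>j=1..n. real (a j) * ln (1 + exp (- real j * (ln y + \<delta> n))))"
  define T where "T = (\<lambda>n. y ^ n * real n powr (- ((r + 2) / (2 * (r + 1)))) *
        exp ((r + 1) / r * G powr (1 / (r + 1)) * real n powr (r / (r + 1))))"
  define R where "R = (\<lambda>n. exp (real n * (ln y + \<delta> n)) / sqrt (2 * pi * V n) *
      (\<Prod>j=1..n. (1 + exp (- real j * (ln y + \<delta> n))) ^ a j))"
  obtain L where L: "(\<lambda>n. S n - K * Gamma r * \<delta> n powr (- r)) \<longlonglongrightarrow> L"
    unfolding S_def using log_partition_expansion by blast
  obtain C where C: "\<forall>\<^sub>F n in sequentially. \<bar>real n - boltz_mean a n (ln y + \<delta> n)\<bar> \<le> C"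
    using mean_expansion by blast
  have "(\<lambda>n. (real n - boltz_mean a n (ln y + \<delta> n)) / sqrt (V n)) \<longlonglongrightarrow> 0"
  proof (rule Lim_null_comparison)
    have top: "filterlim (\<lambda>n. sqrt (V n)) at_top sequentially"
      unfolding V_def by (rule boltz_var_at_top[OF \<delta>_at_right n_\<delta>_at_top])
    show "(\<lambda>n. C / sqrt (V n)) \<longlonglongrightarrow> 0"
      by (rule tendsto_divide_0[OF tendsto_const filterlim_at_top_imp_at_infinity[OF top]])
    have "\<forall>\<^sub>F n in sequentially. sqrt (V n) > 0" using top unfolding filterlim_at_top_dense by blast
    with C show "\<forall>\<^sub>F n in sequentially. norm ((real n - boltz_mean a n (ln y + \<delta> n)) / sqrt (V n)) \<le> C / sqrt (V n)"
      by eventually_elim (auto simp: abs_divide intro!: divide_right_mono)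
  qed
  then have equiv: "selection_num a \<sim>[sequentially] R"
    unfolding R_def V_def by (rule local_limit[OF \<delta>_at_right n_\<delta>_at_top])
  define g where "g = G powr (- ((r + 2) / (2 * (r + 1))))"
  \<comment> \<open>\<open>exp L\<close> stems from the product, the square root from the variance,
    and \<open>g\<close> from turning a power of \<open>\<delta> n\<close> into a power of
    \<open>n\<close>.\<close>
  define \<kappa> where "\<kappa> = exp L / (sqrt (2 * pi * (K * Gamma (r + 2))) * g)"
  have Gam: "K * Gamma (r + 2) > 0" using K_pos r_pos by (intro mult_pos_pos Gamma_real_pos) auto
  have g: "g > 0" using G_pos by (simp add: g_def)
  have \<kappa>: "\<kappa> > 0" unfolding \<kappa>_def using Gam g by (intro divide_pos_pos mult_pos_pos) auto
  have "(\<lambda>n. exp (S n - K * Gamma r * \<delta> n powr (- r)) / (sqrt (2 * pi * (V n * \<delta> n powr (r + 2))) * g)) \<longlonglongrightarrow> \<kappa>"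
    unfolding \<kappa>_def V_def using Gam g by (intro tendsto_intros L var_asymp) auto
  moreover have "\<forall>\<^sub>F n in sequentially.
      exp (S n - K * Gamma r * \<delta> n powr (- r)) / (sqrt (2 * pi * (V n * \<delta> n powr (r + 2))) * g) = R n / T n"
    using eventually_gt_at_top[of 0]
  proof eventually_elim
    case (elim n)
    have d: "\<delta> n > 0" by (rule \<delta>_pos[OF elim])
    have "(\<Prod>j=1..n. (1 + exp (- real j * (ln y + \<delta> n))) ^ a j) = exp (S n)"
    proof -
      have "(1 + exp (- real j * (ln y + \<delta> n))) ^ a j = exp (real (a j) * ln (1 + exp (- real j * (ln y + \<delta> n))))" for j
        by (simp add: exp_of_nat_mult add_pos_pos)
      then show ?thesis by (simp add: S_def exp_sum)
    qed
    moreover have "exp (real n * (ln y + \<delta> n)) = y ^ n * exp (real n * \<delta> n)"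
      using y_gt_1 by (simp add: distrib_left exp_add exp_of_nat_mult)
    ultimately have R: "R n = y ^ n * exp (real n * \<delta> n) * exp (S n) / sqrt (2 * pi * V n)"
      by (simp add: R_def)
    \<comment> \<open>The tilt contributes \<open>n * \<delta> n\<close> and the product
      \<open>K * Gamma r * \<delta> n powr (- r)\<close>, which is \<open>n * \<delta> n / r\<close>
      because \<open>Gamma (r + 1) = r * Gamma r\<close>; hence the factor
      \<open>(r + 1) / r\<close>.\<close>
    have expo: "(r + 1) / r * G powr (1 / (r + 1)) * real n powr (r / (r + 1)) = real n * \<delta> n + K * Gamma r * \<delta> n powr (- r)"
    proof -
      have "real n * \<delta> n = G powr (1 / (r + 1)) * real n powr (r / (r + 1))"
      proof -
        have "r / (r + 1) = 1 - 1 / (r + 1)" using r_pos by (simp add: field_simps)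
        then have "real n powr (r / (r + 1)) = real n / real n powr (1 / (r + 1))"
          using elim by (simp add: powr_diff)
        then show ?thesis using G_pos elim by (simp add: \<delta>_def powr_divide)
      qed
      moreover have "K * Gamma r * \<delta> n powr (- r) = real n * \<delta> n / r"
      proof -
        have "Gamma (r + 1) = r * Gamma r" using r_pos by (intro Gamma_plus1) auto
        then have "real n = r * (K * Gamma r * \<delta> n powr (- (r + 1)))"
          using n_eq_\<delta>[OF elim] by (simp add: G_def)
        moreover have "\<delta> n powr (- (r + 1)) * \<delta> n = \<delta> n powr (- r)"
        proof -
          have "\<delta> n powr (- (r + 1)) * \<delta> n powr 1 = \<delta> n powr (- r)"
            unfolding powr_add[symmetric] by simp
          then show ?thesis using d by simp
        qed
        ultimately have "real n * \<delta> n = r * (K * Gamma r * \<delta> n powr (- r))"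
          by (metis mult.assoc)
        then show ?thesis using r_pos by simp
      qed
      ultimately show ?thesis using r_pos by (simp add: field_simps)
    qed
    \<comment> \<open>The standard deviation has order
      \<open>\<delta> n powr (- (r + 2) / 2)\<close>, and \<open>\<delta> n\<close> has order
      \<open>n powr (- 1 / (r + 1))\<close>; this is the source of the power of \<open>n\<close> in
      the result.\<close>
    have root: "sqrt (\<delta> n powr (r + 2)) * g = real n powr (- ((r + 2) / (2 * (r + 1))))"
    proof -
      have "real n powr (- ((r + 2) / (2 * (r + 1)))) = (G * \<delta> n powr (- (r + 1))) powr (- ((r + 2) / (2 * (r + 1))))"
        by (simp only: n_eq_\<delta>[OF elim, symmetric])
      also have "\<dots> = g * \<delta> n powr (- (r + 1) * (- ((r + 2) / (2 * (r + 1)))))"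
        using G_pos by (simp only: powr_mult powr_powr g_def)
      also have "- (r + 1) * (- ((r + 2) / (2 * (r + 1)))) = (r + 2) * (1 / 2)"
        using r_pos by (simp add: field_simps)
      also have "\<delta> n powr ((r + 2) * (1 / 2)) = sqrt (\<delta> n powr (r + 2))"
        unfolding powr_powr[symmetric] by (simp add: powr_half_sqrt)
      finally show ?thesis by (simp add: mult.commute)
    qed
    have "sqrt (2 * pi * (V n * \<delta> n powr (r + 2))) * g = sqrt (2 * pi * V n) * (sqrt (\<delta> n powr (r + 2)) * g)"
      by (simp add: real_sqrt_mult)
    then have "sqrt (2 * pi * (V n * \<delta> n powr (r + 2))) * g
        = sqrt (2 * pi * V n) * real n powr (- ((r + 2) / (2 * (r + 1))))"
      by (simp only: root)
    moreover have "exp (real n * \<delta> n) * exp (S n) / exp (real n * \<delta> n + K * Gamma r * \<delta> n powr (- r))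
        = exp (S n - K * Gamma r * \<delta> n powr (- r))"
      by (simp add: exp_add exp_diff)
    moreover have "y ^ n \<noteq> 0" using y_gt_1 by simp
    ultimately show ?case
      unfolding R T_def expo by (simp add: field_simps)
  qed
  ultimately have "(\<lambda>n. R n / T n) \<longlonglongrightarrow> \<kappa>" by (rule Lim_transform_eventually)
  then have "(\<lambda>n. R n / T n / \<kappa>) \<longlonglongrightarrow> \<kappa> / \<kappa>" using \<kappa> by (intro tendsto_intros) auto
  then have "(\<lambda>n. R n / (\<kappa> * T n)) \<longlonglongrightarrow> 1" using \<kappa> by (simp add: mult.commute)
  then have "R \<sim>[sequentially] (\<lambda>n. \<kappa> * T n)" by (rule asymp_equivI')
  with equiv have "selection_num a \<sim>[sequentially] (\<lambda>n. \<kappa> * T n)" by (rule asymp_equiv_trans)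
  then show ?thesis using \<kappa> unfolding T_def G_def by (intro exI[of _ \<kappa>]) (simp add: mult.assoc)
qed

end
theorem theorem5:
  fixes a :: "nat \<Rightarrow> nat"
  shows
    "(\<forall>(r::real) (y::real) (D1::real) (D2::real) (\<sigma>::nat \<Rightarrow> real).
        r > 0 \<and> y \<ge> 1 \<and> D1 > 0 \<and> D2 > 0 \<and>
        (\<forall>j\<ge>1. D1 * real j powr (r - 1) * y ^ j \<le> real (a j) \<and>
               real (a j) \<le> D2 * real j powr (r - 1) * y ^ j) \<and>
        (\<forall>\<^sub>F n in sequentially. \<sigma> n > 0 \<and>
           (\<Sum>j=1..n. real j * real (a j) * exp (- real j * \<sigma> n) / (1 + exp (- real j * \<sigma> n)))
             = real n) \<longrightarrow>
        selection_num a \<sim>[sequentially]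
          (\<lambda>n. exp (real n * \<sigma> n) /
               sqrt (2 * pi * (\<Sum>j=1..n. (real j)\<^sup>2 * real (a j) * exp (- real j * \<sigma> n) /
                                      (1 + exp (- real j * \<sigma> n))\<^sup>2)) *
               (\<Prod>j=1..n. (1 + exp (- real j * \<sigma> n)) ^ a j)))
     \<and>
     (\<forall>(K::real) (r::real) (y::real) (\<nu>::real).
        K > 0 \<and> r > 0 \<and> y > 1 \<and> 0 < \<nu> \<and> \<nu> < 1 \<and>
        (\<lambda>j. real (a j) - K * real j powr (r - 1) * y ^ j) \<in> O(\<lambda>j. y powr (\<nu> * real j)) \<longrightarrow>
        (\<exists>\<kappa>1>0.
           selection_num a \<sim>[sequentially]
             (\<lambda>n. \<kappa>1 * y ^ n * real n powr (- ((r + 2) / (2 * (r + 1)))) *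
                  exp ((r + 1) / r * (K * Gamma (r + 1)) powr (1 / (r + 1)) *
                       real n powr (r / (r + 1))))))"
proof (intro conjI allI impI)
  fix r y D1 D2 :: real and \<sigma> :: "nat \<Rightarrow> real"
  assume A: "r > 0 \<and> y \<ge> 1 \<and> D1 > 0 \<and> D2 > 0 \<and>
        (\<forall>j\<ge>1. D1 * real j powr (r - 1) * y ^ j \<le> real (a j) \<and>
               real (a j) \<le> D2 * real j powr (r - 1) * y ^ j) \<and>
        (\<forall>\<^sub>F n in sequentially. \<sigma> n > 0 \<and>
           (\<Sum>j=1..n. real j * real (a j) * exp (- real j * \<sigma> n) / (1 + exp (- real j * \<sigma> n)))
             = real n)"
  then interpret exp_growth a r y D1 D2 1
    by unfold_locales auto
  from A have "\<forall>\<^sub>F n in sequentially. boltz_mean a n (\<sigma> n) = real n"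
    by (auto simp: boltz_mean_def boltz_p_def elim: eventually_mono)
  from saddle_point_asymptotics[OF this]
  show "selection_num a \<sim>[sequentially]
          (\<lambda>n. exp (real n * \<sigma> n) /
               sqrt (2 * pi * (\<Sum>j=1..n. (real j)\<^sup>2 * real (a j) * exp (- real j * \<sigma> n) /
                                      (1 + exp (- real j * \<sigma> n))\<^sup>2)) *
               (\<Prod>j=1..n. (1 + exp (- real j * \<sigma> n)) ^ a j))"
    by (simp add: boltz_var_def boltz_v_def)
next
  fix K r y \<nu> :: real
  assume "K > 0 \<and> r > 0 \<and> y > 1 \<and> 0 < \<nu> \<and> \<nu> < 1 \<and>
        (\<lambda>j. real (a j) - K * real j powr (r - 1) * y ^ j) \<in> O(\<lambda>j. y powr (\<nu> * real j))"
  then interpret explicit_growth a K r y \<nu>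
    by unfold_locales auto
  show "\<exists>\<kappa>1>0.
           selection_num a \<sim>[sequentially]
             (\<lambda>n. \<kappa>1 * y ^ n * real n powr (- ((r + 2) / (2 * (r + 1)))) *
                  exp ((r + 1) / r * (K * Gamma (r + 1)) powr (1 / (r + 1)) *
                       real n powr (r / (r + 1))))"
    by (rule explicit_asymptotics)
qed

end
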